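(* Let $(M,\varphi,\xi,\eta,g)$ be an almost contact B-metric manifold with Levi-Civita connection $\nabla$ of $g$, and let $D$ be the Schouten-van Kampen connection associated to $\nabla$ and adapted to $(\mathcal{H},\mathcal{V})$. Then $D$ is a natural connection for the structure $(\varphi,\xi,\eta,g)$ (i.e. $D\varphi=0$, $D\xi=0$, $D\eta=0$, $Dg=0$) if and only if $(M,\varphi,\xi,\eta,g)$ belongs to the class $\mathcal{U}_2=\mathcal{F}_4\oplus\mathcal{F}_5\oplus\mathcal{F}_6\oplus\mathcal{F}_7\oplus\mathcal{F}_8\oplus\mathcal{F}_9\oplus\mathcal{F}_{11}$. In that case $D$ coincides with the $\varphi$B-connection $\nabla^*$.
   Context: An almost contact B-metric manifold $(M,\varphi,\xi,\eta,g)$ is a smooth $(2n+1)$-dimensional manifold ($n\ge 1$) with an endomorphism $\varphi$ of $TM$, a vector field $\xi$, a 1-form $\eta$ and a pseudo-Riemannian metric $g$ of signature $(n+1,n)$ such that $\varphi\xi=0$, $\varphi^2=-\mathrm{Id}+\eta\otimes\xi$, $\eta\circ\varphi=0$, $\eta(\xi)=1$, and $g(\varphi x,\varphi y)=-g(x,y)+\eta(x)\eta(y)$. Put $\mathcal{H}=\ker\eta$, $\mathcal{V}=\mathrm{span}(\xi)$, $x^h=x-\eta(x)\xi$, $x^v=\eta(x)\xi$. The Schouten-van Kampen connection associated to $\nabla$ and adapted to $(\mathcal{H},\mathcal{V})$ is $D_xy=(\nabla_xy^h)^h+(\nabla_xy^v)^v$. The $\varphi$B-connection is $\nabla^*_xy=\nabla_xy+\frac12\{(\nabla_x\varphi)\varphi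 y+(\nabla_x\eta)(y)\,\xi\}-\eta(y)\nabla_x\xi$. Classes: let $F(x,y,z)=g((\nabla_x\varphi)y,z)$. At each point $F$ lies in the vector space of $(0,3)$-tensors satisfying $F(x,y,z)=F(x,z,y)=F(x,\varphi y,\varphi z)+\eta(y)F(x,\xi,z)+\eta(z)F(x,y,\xi)$. Let $\theta(z)=g^{ij}F(e_i,e_j,z)$, $\theta^*(z)=g^{ij}F(e_i,\varphi e_j,z)$, $\omega(z)=F(\xi,\xi,z)$, where $\{e_1,\dots,e_{2n}\}$ is a basis of $\ker\eta$ at the point and $(g^{ij})$ is the inverse of $(g(e_i,e_j))$. Each of the following conditions (for all $x,y,z$) defines a linear subspace, called a basic class: - $\mathcal{F}_4$: $F(x,y,z)=-\frac{1}{2n}\theta(\xi)\{g(\varphi x,\varphi y)\eta(z)+g(\varphi x,\varphi z)\eta(y)\}$; - $\mathcal{F}_5$: $F(x,y,z)=-\frac{1}{2n}\theta^*(\xi)\{g(x,\varphi y)\eta(z)+g(x,\varphi z)\eta(y)\}$; - $\mathcal{F}_6,\dots,\mathcal{F}_9$: in each case $F(x,y,z)=F(x,y,\xi)\eta(z)+F(x,z,\xi)\eta(y)$ and, respectively, $\mathcal{F}_6$: $F(x,y,\xi)=F(y,x,\xi)=-F(\varphi x,\varphi y,\xi)$, $\theta=\theta^*=0$; $\mathcal{F}_7$: $F(x,y,\xi)=-F(y,x,\xi)=-F(\varphi x,\varphi y,\xi)$; $\mathcal{F}_8$: $F(x,y,\xi)=F(y,x,\xi)=F(\varphi x,\varphi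 y,\xi)$; $\mathcal{F}_9$: $F(x,y,\xi)=-F(y,x,\xi)=F(\varphi x,\varphi y,\xi)$; - $\mathcal{F}_{11}$: $F(x,y,z)=\eta(x)\{\eta(y)\omega(z)+\eta(z)\omega(y)\}$. A manifold belongs to a direct sum of basic classes if at every point $F$ lies in the direct sum of the corresponding subspaces. *)

theory Defs
  imports "HOL-Analysis.Analysis" "HOL-Library.Function_Algebras" "HOL-Library.Set_Algebras"
begin

section \<open>Functions with values in a vector space\<close>

text \<open>Tangent vectors, vector fields and tensors at a point are functions, added and scaled
  pointwise.  Addition on function types comes from \<^theory>\<open>HOL-Library.Function_Algebras\<close>.\<close>

instantiation "fun" :: (type, real_vector) real_vector
begin

definition scaleR_fun_def: "r *\<^sub>R f = (\<lambda>x. r *\<^sub>R f x)"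

instance
  by standard (auto simp: scaleR_fun_def plus_fun_def fun_eq_iff scaleR_add_right scaleR_add_left)

end

definition linear_map_on :: "'v::real_vector set \<Rightarrow> ('v \<Rightarrow> 'w::real_vector) \<Rightarrow> bool" where
  "linear_map_on V f \<longleftrightarrow>
     (\<forall>x\<in>V. \<forall>y\<in>V. \<forall>a b. f (a *\<^sub>R x + b *\<^sub>R y) = a *\<^sub>R f x + b *\<^sub>R f y)"


section \<open>Smooth manifolds\<close>

text \<open>The sets \<open>S\<close> to which the next two definitions are applied are open.\<close>

primrec Ck_on :: "nat \<Rightarrow> 'b::real_normed_vector set \<Rightarrow> ('b \<Rightarrow> 'c::real_normed_vector) \<Rightarrow> bool" where
  "Ck_on 0 S f \<longleftrightarrow> continuous_on S f"
| "Ck_on (Suc k) S f \<longleftrightarrow>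
     (\<forall>x\<in>S. f differentiable (at x)) \<and> (\<forall>v. Ck_on k S (\<lambda>x. frechet_derivative f (at x) v))"

definition smooth_on :: "'b::real_normed_vector set \<Rightarrow> ('b \<Rightarrow> 'c::real_normed_vector) \<Rightarrow> bool" where
  "smooth_on S f \<longleftrightarrow> (\<forall>k. Ck_on k S f)"

text \<open>A chart is a pair of its domain and its coordinate map; the dimension of the manifold
  is the dimension of the Euclidean space \<open>'e\<close>.\<close>

record ('a, 'e) manifold =
  mtop :: "'a topology"
  charts :: "('a set \<times> ('a \<Rightarrow> 'e)) set"

abbreviation points :: "('a, 'e) manifold \<Rightarrow> 'a set" where
  "points M \<equiv> topspace (mtop M)"

definition smooth_manifold :: "('a, 'e::euclidean_space) manifold \<Rightarrow> bool" where
  "smooth_manifold M \<longleftrightarrow>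
     Hausdorff_space (mtop M) \<and> second_countable (mtop M) \<and>
     (\<Union>(U, \<kappa>)\<in>charts M. U) = points M \<and>
     (\<forall>(U, \<kappa>)\<in>charts M. openin (mtop M) U \<and> open (\<kappa> ` U) \<and>
        homeomorphic_map (subtopology (mtop M) U) (top_of_set (\<kappa> ` U)) \<kappa>) \<and>
     (\<forall>(U, \<kappa>)\<in>charts M. \<forall>(V, \<psi>)\<in>charts M.
        smooth_on (\<kappa> ` (U \<inter> V)) (\<psi> \<circ> inv_into U \<kappa>))"

definition smooth_functions :: "('a, 'e::euclidean_space) manifold \<Rightarrow> ('a \<Rightarrow> real) set" where
  "smooth_functions M = {f. \<forall>(U, \<kappa>)\<in>charts M. smooth_on (\<kappa> ` U) (f \<circ> inv_into U \<kappa>)}"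

definition smooth_curve :: "('a, 'e::euclidean_space) manifold \<Rightarrow> real \<Rightarrow> (real \<Rightarrow> 'a) \<Rightarrow> bool" where
  "smooth_curve M \<epsilon> c \<longleftrightarrow>
     \<epsilon> > 0 \<and> continuous_map (top_of_set {-\<epsilon><..<\<epsilon>}) (mtop M) c \<and>
     (\<forall>(U, \<kappa>)\<in>charts M. smooth_on {t \<in> {-\<epsilon><..<\<epsilon>}. c t \<in> U} (\<kappa> \<circ> c))"

text \<open>A tangent vector at \<open>p\<close> is the velocity at time \<open>0\<close> of a smooth curve through \<open>p\<close>, seen as
  the operator \<open>f \<mapsto> (f \<circ> c)'(0)\<close> on smooth functions.  It is set to \<open>0\<close> on all other
  functions, so that two tangent vectors are equal iff they agree on smooth functions.\<close>

type_synonym 'a tvector = "('a \<Rightarrow> real) \<Rightarrow> real"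

definition velocity :: "('a, 'e::euclidean_space) manifold \<Rightarrow> (real \<Rightarrow> 'a) \<Rightarrow> 'a tvector" where
  "velocity M c = (\<lambda>f. if f \<in> smooth_functions M then deriv (\<lambda>t. f (c t)) 0 else 0)"

definition tangent_space :: "('a, 'e::euclidean_space) manifold \<Rightarrow> 'a \<Rightarrow> 'a tvector set" where
  "tangent_space M p = {velocity M c |c \<epsilon>. smooth_curve M \<epsilon> c \<and> c 0 = p}"

text \<open>Vector fields are normalised to \<open>0\<close> outside the manifold, so that equal vector fields are
  equal as functions.\<close>

type_synonym 'a vfield = "'a \<Rightarrow> 'a tvector"

definition vector_fields :: "('a, 'e::euclidean_space) manifold \<Rightarrow> 'a vfield set" where
  "vector_fields M = {X. (\<forall>p\<in>points M. X p \<in> tangent_space M p) \<and> (\<forall>p. p \<notin> points M \<longrightarrow> X p = 0) \<and>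
     (\<forall>f\<in>smooth_functions M. (\<lambda>p. X p f) \<in> smooth_functions M)}"

definition lie_bracket :: "'a vfield \<Rightarrow> 'a vfield \<Rightarrow> 'a vfield" where
  "lie_bracket X Y = (\<lambda>p f. X p (\<lambda>q. Y q f) - Y p (\<lambda>q. X q f))"

text \<open>Smooth tensor fields are given pointwise; smoothness means that smooth vector fields are sent
  to smooth vector fields or functions.\<close>

definition endomorphism_field ::
    "('a, 'e::euclidean_space) manifold \<Rightarrow> ('a \<Rightarrow> 'a tvector \<Rightarrow> 'a tvector) \<Rightarrow> bool" where
  "endomorphism_field M \<phi> \<longleftrightarrow>
     (\<forall>p\<in>points M. \<phi> p ` tangent_space M p \<subseteq> tangent_space M p \<and>
        linear_map_on (tangent_space M p) (\<phi> p)) \<and>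
     (\<forall>X\<in>vector_fields M. (\<lambda>p. \<phi> p (X p)) \<in> vector_fields M)"

definition one_form :: "('a, 'e::euclidean_space) manifold \<Rightarrow> ('a \<Rightarrow> 'a tvector \<Rightarrow> real) \<Rightarrow> bool" where
  "one_form M \<eta> \<longleftrightarrow>
     (\<forall>p\<in>points M. linear_map_on (tangent_space M p) (\<eta> p)) \<and>
     (\<forall>X\<in>vector_fields M. (\<lambda>p. \<eta> p (X p)) \<in> smooth_functions M)"

definition has_signature ::
    "'v::real_vector set \<Rightarrow> ('v \<Rightarrow> 'v \<Rightarrow> real) \<Rightarrow> nat \<Rightarrow> nat \<Rightarrow> bool" where
  "has_signature V h r s \<longleftrightarrow>
     (\<exists>P N. finite P \<and> finite N \<and> P \<inter> N = {} \<and> card P = r \<and> card N = s \<and>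
        independent (P \<union> N) \<and> span (P \<union> N) = V \<and>
        (\<forall>x\<in>P. h x x = 1) \<and> (\<forall>x\<in>N. h x x = -1) \<and>
        (\<forall>x\<in>P \<union> N. \<forall>y\<in>P \<union> N. x \<noteq> y \<longrightarrow> h x y = 0))"

definition pseudo_Riemannian_metric ::
    "('a, 'e::euclidean_space) manifold \<Rightarrow> nat \<Rightarrow> nat \<Rightarrow> ('a \<Rightarrow> 'a tvector \<Rightarrow> 'a tvector \<Rightarrow> real) \<Rightarrow> bool" where
  "pseudo_Riemannian_metric M r s g \<longleftrightarrow>
     (\<forall>p\<in>points M.
        (\<forall>x\<in>tangent_space M p. linear_map_on (tangent_space M p) (g p x)) \<and>
        (\<forall>x\<in>tangent_space M p. \<forall>y\<in>tangent_space M p. g p x y = g p y x) \<and>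
        has_signature (tangent_space M p) (g p) r s) \<and>
     (\<forall>X\<in>vector_fields M. \<forall>Y\<in>vector_fields M. (\<lambda>p. g p (X p) (Y p)) \<in> smooth_functions M)"


section \<open>Linear connections\<close>

type_synonym 'a connection = "'a vfield \<Rightarrow> 'a vfield \<Rightarrow> 'a vfield"

definition linear_connection :: "('a, 'e::euclidean_space) manifold \<Rightarrow> 'a connection \<Rightarrow> bool" where
  "linear_connection M C \<longleftrightarrow>
     (\<forall>X\<in>vector_fields M. \<forall>Y\<in>vector_fields M. C X Y \<in> vector_fields M) \<and>
     (\<forall>X\<in>vector_fields M. \<forall>X'\<in>vector_fields M. \<forall>Y\<in>vector_fields M. C (X + X') Y = C X Y + C X' Y) \<and>
     (\<forall>X\<in>vector_fields M. \<forall>Y\<in>vector_fields M. \<forall>Y'\<in>vector_fields M. C X (Y + Y') = C X Y + C X Y') \<and>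
     (\<forall>f\<in>smooth_functions M. \<forall>X\<in>vector_fields M. \<forall>Y\<in>vector_fields M.
        C (\<lambda>p. f p *\<^sub>R X p) Y = (\<lambda>p. f p *\<^sub>R C X Y p) \<and>
        C X (\<lambda>p. f p *\<^sub>R Y p) = (\<lambda>p. X p f *\<^sub>R Y p + f p *\<^sub>R C X Y p))"

text \<open>Covariant derivatives of an endomorphism field, a 1-form and a metric:
  \<open>(C\<^sub>X\<phi>)Y\<close>, \<open>(C\<^sub>X\<eta>)(Y)\<close> and \<open>(C\<^sub>Xg)(Y,Z)\<close>.\<close>

definition deriv_endo ::
    "'a connection \<Rightarrow> ('a \<Rightarrow> 'a tvector \<Rightarrow> 'a tvector) \<Rightarrow> 'a vfield \<Rightarrow> 'a vfield \<Rightarrow> 'a vfield" where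
  "deriv_endo C \<phi> X Y = (\<lambda>p. C X (\<lambda>q. \<phi> q (Y q)) p - \<phi> p (C X Y p))"

definition deriv_form ::
    "'a connection \<Rightarrow> ('a \<Rightarrow> 'a tvector \<Rightarrow> real) \<Rightarrow> 'a vfield \<Rightarrow> 'a vfield \<Rightarrow> 'a \<Rightarrow> real" where
  "deriv_form C \<eta> X Y = (\<lambda>p. X p (\<lambda>q. \<eta> q (Y q)) - \<eta> p (C X Y p))"

definition deriv_metric ::
    "'a connection \<Rightarrow> ('a \<Rightarrow> 'a tvector \<Rightarrow> 'a tvector \<Rightarrow> real) \<Rightarrow>
      'a vfield \<Rightarrow> 'a vfield \<Rightarrow> 'a vfield \<Rightarrow> 'a \<Rightarrow> real" where
  "deriv_metric C g X Y Z =
     (\<lambda>p. X p (\<lambda>q. g q (Y q) (Z q)) - g p (C X Y p) (Z p) - g p (Y p) (C X Z p))"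

definition Levi_Civita_connection ::
    "('a, 'e::euclidean_space) manifold \<Rightarrow> ('a \<Rightarrow> 'a tvector \<Rightarrow> 'a tvector \<Rightarrow> real) \<Rightarrow>
      'a connection \<Rightarrow> bool" where
  "Levi_Civita_connection M g C \<longleftrightarrow>
     linear_connection M C \<and>
     (\<forall>X\<in>vector_fields M. \<forall>Y\<in>vector_fields M. C X Y - C Y X = lie_bracket X Y) \<and>
     (\<forall>X\<in>vector_fields M. \<forall>Y\<in>vector_fields M. \<forall>Z\<in>vector_fields M. \<forall>p\<in>points M.
        deriv_metric C g X Y Z p = 0)"


section \<open>Almost contact B-metric manifolds\<close>

definition almost_contact_B_metric_manifold ::
    "('a, 'e::euclidean_space) manifold \<Rightarrow> nat \<Rightarrow> ('a \<Rightarrow> 'a tvector \<Rightarrow> 'a tvector) \<Rightarrow> 'a vfield \<Rightarrow>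
      ('a \<Rightarrow> 'a tvector \<Rightarrow> real) \<Rightarrow> ('a \<Rightarrow> 'a tvector \<Rightarrow> 'a tvector \<Rightarrow> real) \<Rightarrow> bool" where
  "almost_contact_B_metric_manifold M n \<phi> \<xi> \<eta> g \<longleftrightarrow>
     smooth_manifold M \<and> n \<ge> 1 \<and> DIM('e) = 2 * n + 1 \<and>
     endomorphism_field M \<phi> \<and> \<xi> \<in> vector_fields M \<and> one_form M \<eta> \<and>
     pseudo_Riemannian_metric M (n + 1) n g \<and>
     (\<forall>p\<in>points M.
        \<phi> p (\<xi> p) = 0 \<and> \<eta> p (\<xi> p) = 1 \<and>
        (\<forall>x\<in>tangent_space M p. \<phi> p (\<phi> p x) = - x + \<eta> p x *\<^sub>R \<xi> p \<and> \<eta> p (\<phi> p x) = 0 \<and>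
           (\<forall>y\<in>tangent_space M p. g p (\<phi> p x) (\<phi> p y) = - g p x y + \<eta> p x * \<eta> p y)))"

definition hpart :: "'a vfield \<Rightarrow> ('a \<Rightarrow> 'a tvector \<Rightarrow> real) \<Rightarrow> 'a vfield \<Rightarrow> 'a vfield" where
  "hpart \<xi> \<eta> X = (\<lambda>p. X p - \<eta> p (X p) *\<^sub>R \<xi> p)"

definition vpart :: "'a vfield \<Rightarrow> ('a \<Rightarrow> 'a tvector \<Rightarrow> real) \<Rightarrow> 'a vfield \<Rightarrow> 'a vfield" where
  "vpart \<xi> \<eta> X = (\<lambda>p. \<eta> p (X p) *\<^sub>R \<xi> p)"

definition Schouten_van_Kampen ::
    "'a vfield \<Rightarrow> ('a \<Rightarrow> 'a tvector \<Rightarrow> real) \<Rightarrow> 'a connection \<Rightarrow> 'a connection" where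
  "Schouten_van_Kampen \<xi> \<eta> C =
     (\<lambda>X Y. hpart \<xi> \<eta> (C X (hpart \<xi> \<eta> Y)) + vpart \<xi> \<eta> (C X (vpart \<xi> \<eta> Y)))"

definition phiB_connection ::
    "('a \<Rightarrow> 'a tvector \<Rightarrow> 'a tvector) \<Rightarrow> 'a vfield \<Rightarrow> ('a \<Rightarrow> 'a tvector \<Rightarrow> real) \<Rightarrow>
      'a connection \<Rightarrow> 'a connection" where
  "phiB_connection \<phi> \<xi> \<eta> C =
     (\<lambda>X Y p. C X Y p
        + (1/2) *\<^sub>R (deriv_endo C \<phi> X (\<lambda>q. \<phi> q (Y q)) p + deriv_form C \<eta> X Y p *\<^sub>R \<xi> p)
        - \<eta> p (Y p) *\<^sub>R C X \<xi> p)"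

definition natural_connection ::
    "('a, 'e::euclidean_space) manifold \<Rightarrow> ('a \<Rightarrow> 'a tvector \<Rightarrow> 'a tvector) \<Rightarrow> 'a vfield \<Rightarrow>
      ('a \<Rightarrow> 'a tvector \<Rightarrow> real) \<Rightarrow> ('a \<Rightarrow> 'a tvector \<Rightarrow> 'a tvector \<Rightarrow> real) \<Rightarrow> 'a connection \<Rightarrow> bool" where
  "natural_connection M \<phi> \<xi> \<eta> g C \<longleftrightarrow>
     linear_connection M C \<and>
     (\<forall>X\<in>vector_fields M. \<forall>p\<in>points M.
        C X \<xi> p = 0 \<and>
        (\<forall>Y\<in>vector_fields M. deriv_endo C \<phi> X Y p = 0 \<and> deriv_form C \<eta> X Y p = 0 \<and>
           (\<forall>Z\<in>vector_fields M. deriv_metric C g X Y Z p = 0)))"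


section \<open>The fundamental tensor and the basic classes\<close>

type_synonym 'a tensor3 = "'a tvector \<Rightarrow> 'a tvector \<Rightarrow> 'a tvector \<Rightarrow> real"

text \<open>\<open>F(x,y,z) = g((\<nabla>\<^sub>x\<phi>)y,z)\<close> at \<open>p\<close> is computed by extending \<open>x\<close> and \<open>y\<close> to vector fields; since
  \<open>\<nabla>\<phi>\<close> is a tensor field the choice of the extensions is irrelevant.  Tensors at \<open>p\<close> are
  normalised to vanish when some argument is not tangent at \<open>p\<close>.\<close>

definition extension_field ::
    "('a, 'e::euclidean_space) manifold \<Rightarrow> 'a \<Rightarrow> 'a tvector \<Rightarrow> 'a vfield" where
  "extension_field M p x = (SOME X. X \<in> vector_fields M \<and> X p = x)"

definition fundamental_tensor ::
    "('a, 'e::euclidean_space) manifold \<Rightarrow> ('a \<Rightarrow> 'a tvector \<Rightarrow> 'a tvector) \<Rightarrow>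
      ('a \<Rightarrow> 'a tvector \<Rightarrow> 'a tvector \<Rightarrow> real) \<Rightarrow> 'a connection \<Rightarrow> 'a \<Rightarrow> 'a tensor3" where
  "fundamental_tensor M \<phi> g C p =
     (\<lambda>x y z. if x \<in> tangent_space M p \<and> y \<in> tangent_space M p \<and> z \<in> tangent_space M p
        then g p (deriv_endo C \<phi> (extension_field M p x) (extension_field M p y) p) z else 0)"

text \<open>From here on everything is linear algebra in one vector space \<open>V\<close> (to be instantiated by a
  tangent space) with an almost contact B-metric structure \<open>(\<phi>,\<xi>,\<eta>,g)\<close> on it.\<close>

definition F_space ::
    "'v::real_vector set \<Rightarrow> ('v \<Rightarrow> 'v) \<Rightarrow> 'v \<Rightarrow> ('v \<Rightarrow> real) \<Rightarrow> ('v \<Rightarrow> 'v \<Rightarrow> 'v \<Rightarrow> real) set" where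
  "F_space V \<phi> \<xi> \<eta> = {F.
     (\<forall>x y z. \<not> (x \<in> V \<and> y \<in> V \<and> z \<in> V) \<longrightarrow> F x y z = 0) \<and>
     (\<forall>x\<in>V. \<forall>y\<in>V. linear_map_on V (\<lambda>w. F w x y) \<and> linear_map_on V (\<lambda>w. F x w y) \<and>
        linear_map_on V (\<lambda>w. F x y w)) \<and>
     (\<forall>x\<in>V. \<forall>y\<in>V. \<forall>z\<in>V. F x y z = F x z y \<and>
        F x y z = F x (\<phi> y) (\<phi> z) + \<eta> y * F x \<xi> z + \<eta> z * F x y \<xi>)}"

text \<open>\<open>metric_trace H g T = g\<^sup>i\<^sup>j T(e\<^sub>i,e\<^sub>j)\<close> for a basis \<open>{e\<^sub>i}\<close> of \<open>H\<close>; it does not depend on the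
  chosen basis when \<open>H\<close> is finite-dimensional, \<open>T\<close> is bilinear and \<open>g\<close> is nondegenerate on \<open>H\<close>.\<close>

definition inverse_matrix_on :: "'v set \<Rightarrow> ('v \<Rightarrow> 'v \<Rightarrow> real) \<Rightarrow> 'v \<Rightarrow> 'v \<Rightarrow> real" where
  "inverse_matrix_on B g =
     (SOME G. \<forall>a\<in>B. \<forall>c\<in>B. (\<Sum>b\<in>B. G a b * g b c) = (if a = c then 1 else 0))"

definition metric_trace ::
    "'v::real_vector set \<Rightarrow> ('v \<Rightarrow> 'v \<Rightarrow> real) \<Rightarrow> ('v \<Rightarrow> 'v \<Rightarrow> real) \<Rightarrow> real" where
  "metric_trace H g T =
     (let B = (SOME B. independent B \<and> span B = H)
      in \<Sum>a\<in>B. \<Sum>b\<in>B. inverse_matrix_on B g a b * T a b)"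

definition ker_on :: "'v set \<Rightarrow> ('v \<Rightarrow> real) \<Rightarrow> 'v set" where
  "ker_on V \<eta> = {x \<in> V. \<eta> x = 0}"

definition theta ::
    "'v::real_vector set \<Rightarrow> ('v \<Rightarrow> real) \<Rightarrow> ('v \<Rightarrow> 'v \<Rightarrow> real) \<Rightarrow>
      ('v \<Rightarrow> 'v \<Rightarrow> 'v \<Rightarrow> real) \<Rightarrow> 'v \<Rightarrow> real" where
  "theta V \<eta> g F z = metric_trace (ker_on V \<eta>) g (\<lambda>x y. F x y z)"

definition theta_star ::
    "'v::real_vector set \<Rightarrow> ('v \<Rightarrow> 'v) \<Rightarrow> ('v \<Rightarrow> real) \<Rightarrow> ('v \<Rightarrow> 'v \<Rightarrow> real) \<Rightarrow>
      ('v \<Rightarrow> 'v \<Rightarrow> 'v \<Rightarrow> real) \<Rightarrow> 'v \<Rightarrow> real" where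
  "theta_star V \<phi> \<eta> g F z = metric_trace (ker_on V \<eta>) g (\<lambda>x y. F x (\<phi> y) z)"

definition omega :: "'v \<Rightarrow> ('v \<Rightarrow> 'v \<Rightarrow> 'v \<Rightarrow> real) \<Rightarrow> 'v \<Rightarrow> real" where
  "omega \<xi> F z = F \<xi> \<xi> z"

definition class_F4 ::
    "'v::real_vector set \<Rightarrow> nat \<Rightarrow> ('v \<Rightarrow> 'v) \<Rightarrow> 'v \<Rightarrow> ('v \<Rightarrow> real) \<Rightarrow> ('v \<Rightarrow> 'v \<Rightarrow> real) \<Rightarrow>
      ('v \<Rightarrow> 'v \<Rightarrow> 'v \<Rightarrow> real) set" where
  "class_F4 V n \<phi> \<xi> \<eta> g = {F \<in> F_space V \<phi> \<xi> \<eta>. \<forall>x\<in>V. \<forall>y\<in>V. \<forall>z\<in>V.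
     F x y z = - (1 / (2 * real n)) * theta V \<eta> g F \<xi> * (g (\<phi> x) (\<phi> y) * \<eta> z + g (\<phi> x) (\<phi> z) * \<eta> y)}"

definition class_F5 ::
    "'v::real_vector set \<Rightarrow> nat \<Rightarrow> ('v \<Rightarrow> 'v) \<Rightarrow> 'v \<Rightarrow> ('v \<Rightarrow> real) \<Rightarrow> ('v \<Rightarrow> 'v \<Rightarrow> real) \<Rightarrow>
      ('v \<Rightarrow> 'v \<Rightarrow> 'v \<Rightarrow> real) set" where
  "class_F5 V n \<phi> \<xi> \<eta> g = {F \<in> F_space V \<phi> \<xi> \<eta>. \<forall>x\<in>V. \<forall>y\<in>V. \<forall>z\<in>V.
     F x y z = - (1 / (2 * real n)) * theta_star V \<phi> \<eta> g F \<xi> * (g x (\<phi> y) * \<eta> z + g x (\<phi> z) * \<eta> y)}"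

text \<open>The condition common to the classes \<open>F\<^sub>6, \<dots>, F\<^sub>9\<close>.\<close>

definition vertical_F_space ::
    "'v::real_vector set \<Rightarrow> ('v \<Rightarrow> 'v) \<Rightarrow> 'v \<Rightarrow> ('v \<Rightarrow> real) \<Rightarrow> ('v \<Rightarrow> 'v \<Rightarrow> 'v \<Rightarrow> real) set" where
  "vertical_F_space V \<phi> \<xi> \<eta> = {F \<in> F_space V \<phi> \<xi> \<eta>. \<forall>x\<in>V. \<forall>y\<in>V. \<forall>z\<in>V.
     F x y z = F x y \<xi> * \<eta> z + F x z \<xi> * \<eta> y}"

definition class_F6 ::
    "'v::real_vector set \<Rightarrow> ('v \<Rightarrow> 'v) \<Rightarrow> 'v \<Rightarrow> ('v \<Rightarrow> real) \<Rightarrow> ('v \<Rightarrow> 'v \<Rightarrow> real) \<Rightarrow>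
      ('v \<Rightarrow> 'v \<Rightarrow> 'v \<Rightarrow> real) set" where
  "class_F6 V \<phi> \<xi> \<eta> g = {F \<in> vertical_F_space V \<phi> \<xi> \<eta>.
     (\<forall>x\<in>V. \<forall>y\<in>V. F x y \<xi> = F y x \<xi> \<and> F x y \<xi> = - F (\<phi> x) (\<phi> y) \<xi>) \<and>
     (\<forall>z\<in>V. theta V \<eta> g F z = 0 \<and> theta_star V \<phi> \<eta> g F z = 0)}"

definition class_F7 ::
    "'v::real_vector set \<Rightarrow> ('v \<Rightarrow> 'v) \<Rightarrow> 'v \<Rightarrow> ('v \<Rightarrow> real) \<Rightarrow> ('v \<Rightarrow> 'v \<Rightarrow> 'v \<Rightarrow> real) set" where
  "class_F7 V \<phi> \<xi> \<eta> = {F \<in> vertical_F_space V \<phi> \<xi> \<eta>.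
     \<forall>x\<in>V. \<forall>y\<in>V. F x y \<xi> = - F y x \<xi> \<and> F x y \<xi> = - F (\<phi> x) (\<phi> y) \<xi>}"

definition class_F8 ::
    "'v::real_vector set \<Rightarrow> ('v \<Rightarrow> 'v) \<Rightarrow> 'v \<Rightarrow> ('v \<Rightarrow> real) \<Rightarrow> ('v \<Rightarrow> 'v \<Rightarrow> 'v \<Rightarrow> real) set" where
  "class_F8 V \<phi> \<xi> \<eta> = {F \<in> vertical_F_space V \<phi> \<xi> \<eta>.
     \<forall>x\<in>V. \<forall>y\<in>V. F x y \<xi> = F y x \<xi> \<and> F x y \<xi> = F (\<phi> x) (\<phi> y) \<xi>}"

definition class_F9 ::
    "'v::real_vector set \<Rightarrow> ('v \<Rightarrow> 'v) \<Rightarrow> 'v \<Rightarrow> ('v \<Rightarrow> real) \<Rightarrow> ('v \<Rightarrow> 'v \<Rightarrow> 'v \<Rightarrow> real) set" where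
  "class_F9 V \<phi> \<xi> \<eta> = {F \<in> vertical_F_space V \<phi> \<xi> \<eta>.
     \<forall>x\<in>V. \<forall>y\<in>V. F x y \<xi> = - F y x \<xi> \<and> F x y \<xi> = F (\<phi> x) (\<phi> y) \<xi>}"

definition class_F11 ::
    "'v::real_vector set \<Rightarrow> ('v \<Rightarrow> 'v) \<Rightarrow> 'v \<Rightarrow> ('v \<Rightarrow> real) \<Rightarrow> ('v \<Rightarrow> 'v \<Rightarrow> 'v \<Rightarrow> real) set" where
  "class_F11 V \<phi> \<xi> \<eta> = {F \<in> F_space V \<phi> \<xi> \<eta>. \<forall>x\<in>V. \<forall>y\<in>V. \<forall>z\<in>V.
     F x y z = \<eta> x * (\<eta> y * omega \<xi> F z + \<eta> z * omega \<xi> F y)}"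

text \<open>The sum of subsets is \<open>A + B = {a + b | a \<in> A, b \<in> B}\<close> from
  \<^theory>\<open>HOL-Library.Set_Algebras\<close>: an internal direct sum of subspaces is, as a set, their sum.\<close>

definition class_U2 ::
    "'v::real_vector set \<Rightarrow> nat \<Rightarrow> ('v \<Rightarrow> 'v) \<Rightarrow> 'v \<Rightarrow> ('v \<Rightarrow> real) \<Rightarrow> ('v \<Rightarrow> 'v \<Rightarrow> real) \<Rightarrow>
      ('v \<Rightarrow> 'v \<Rightarrow> 'v \<Rightarrow> real) set" where
  "class_U2 V n \<phi> \<xi> \<eta> g =
     class_F4 V n \<phi> \<xi> \<eta> g + class_F5 V n \<phi> \<xi> \<eta> g + class_F6 V \<phi> \<xi> \<eta> g + class_F7 V \<phi> \<xi> \<eta> +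
     class_F8 V \<phi> \<xi> \<eta> + class_F9 V \<phi> \<xi> \<eta> + class_F11 V \<phi> \<xi> \<eta>"

definition belongs_to_U2 ::
    "('a, 'e::euclidean_space) manifold \<Rightarrow> nat \<Rightarrow> ('a \<Rightarrow> 'a tvector \<Rightarrow> 'a tvector) \<Rightarrow> 'a vfield \<Rightarrow>
      ('a \<Rightarrow> 'a tvector \<Rightarrow> real) \<Rightarrow> ('a \<Rightarrow> 'a tvector \<Rightarrow> 'a tvector \<Rightarrow> real) \<Rightarrow> 'a connection \<Rightarrow> bool" where
  "belongs_to_U2 M n \<phi> \<xi> \<eta> g C \<longleftrightarrow>
     (\<forall>p\<in>points M. fundamental_tensor M \<phi> g C p
        \<in> class_U2 (tangent_space M p) n (\<phi> p) (\<xi> p) (\<eta> p) (g p))"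

end

theory Submission
  imports Defs "HOL-Real_Asymp.Real_Asymp"
begin

text \<open>The Leibniz rule and \<open>\<nabla>g = 0\<close> turn the definition of the Schouten-van Kampen connection into
  \<open>D\<^sub>xy = \<nabla>\<^sub>xy - \<eta>(y)\<nabla>\<^sub>x\<xi> + (\<nabla>\<^sub>x\<eta>)(y)\<xi>\<close> (lemma \<open>Schouten_van_Kampen_eq\<close>).  From this formula \<open>D\<close>
  always preserves \<open>\<xi>\<close>, \<open>\<eta>\<close> and \<open>g\<close>, so that \<open>D\<close> is natural iff \<open>D\<phi> = 0\<close>.  Moreover
  \<open>F(x,y,\<xi>) = -g(\<nabla>\<^sub>x\<xi>,\<phi>y)\<close>, and therefore
  \<open>g((D\<^sub>x\<phi>)y, z) = F(x,y,z) - F(x,y,\<xi>)\<eta>(z) - F(x,z,\<xi>)\<eta>(y)\<close> (lemma \<open>g_Schouten_van_Kampen_\<phi>\<close>).  Thus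
  \<open>D\<close> is natural iff at every point \<open>F\<close> is vertical, that is, satisfies the condition common to
  \<open>F\<^sub>6, \<dots>, F\<^sub>9\<close>.

  It remains to see that \<open>U\<^sub>2\<close> is the space of all vertical tensors (lemma \<open>class_U2_eq\<close>), which is linear
  algebra in one tangent space.  A vertical tensor is the same as a bilinear form \<open>S(x,y) = F(x,y,\<xi>)\<close> with
  \<open>S(x,\<xi>) = 0\<close>.  The part \<open>\<eta>(x)S(\<xi>,y)\<close> is the component in \<open>F\<^sub>1\<^sub>1\<close>, and the rest splits according to
  symmetry or antisymmetry and to the sign in \<open>S(\<phi>x,\<phi>y) = \<plusminus>S(x,y)\<close>.  Three of the four types are \<open>F\<^sub>7\<close>, \<open>F\<^sub>8\<close>,
  \<open>F\<^sub>9\<close>.  In the remaining type (symmetric, sign \<open>-\<close>) suitable multiples of \<open>g(\<phi>x,\<phi>y)\<close> and \<open>g(x,\<phi>y)\<close>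
  carry the traces \<open>\<theta>(\<xi>)\<close> and \<open>\<theta>\<^sup>*(\<xi>)\<close>; they are the components in \<open>F\<^sub>4\<close> and \<open>F\<^sub>5\<close>, and what is left lies in
  \<open>F\<^sub>6\<close>.

  All this takes for granted that \<open>F\<close> is a tensor at a point and satisfies the identities of
  \<^const>\<open>F_space\<close>.  Every tangent vector extends to a global smooth vector field, and an operator on
  vector fields that is linear over the smooth functions depends on the value of its argument at the point
  only (lemmas \<open>extension_field\<close> and \<open>tensoriality\<close>).  Both facts come from bump functions in a chart, for
  which tangent vectors have to be described in coordinates
  (lemma \<open>tangent_space_eq_range_chart_vector\<close>).\<close>

section \<open>Calculus of \<open>C\<^sup>k\<close> maps\<close>

lemma Ck_on_cong:
  assumes "open S" "\<And>x. x \<in> S \<Longrightarrow> f x = g x" "Ck_on k S f"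
  shows "Ck_on k S g"
  using assms(2,3)
proof (induction k arbitrary: f g)
  case 0
  then show ?case by (simp cong: continuous_on_cong)
next
  case (Suc k)
  have D: "(g has_derivative frechet_derivative f (at x)) (at x)" if "x \<in> S" for x
    using Suc.prems that assms(1)
    by (metis Ck_on.simps(2) frechet_derivative_works has_derivative_transform_within_open)
  have eq: "frechet_derivative f (at x) v = frechet_derivative g (at x) v" if "x \<in> S" for x v
    using frechet_derivative_at[OF D[OF that]] by simp
  show ?case
    using D Suc.IH[OF eq] Suc.prems(2) by (auto simp: differentiable_def)
qed

lemma Ck_on_SucI:
  assumes "open S" "\<And>x. x \<in> S \<Longrightarrow> (f has_derivative f' x) (at x)" "\<And>v. Ck_on k S (\<lambda>x. f' x v)"
  shows "Ck_on (Suc k) S f"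
  using assms Ck_on_cong[OF assms(1) _ assms(3)] frechet_derivative_at[OF assms(2)]
  by (auto simp: differentiable_def)

lemma Ck_on_SucD:
  assumes "Ck_on (Suc k) S f" "x \<in> S"
  shows "(f has_derivative frechet_derivative f (at x)) (at x)"
  using assms by (simp add: frechet_derivative_works[symmetric])

lemma Ck_on_Suc_imp: "Ck_on (Suc k) S f \<Longrightarrow> Ck_on k S f"
proof (induction k arbitrary: f)
  case 0
  then show ?case
    by (auto intro!: continuous_at_imp_continuous_on differentiable_imp_continuous_within)
next
  case (Suc k)
  then show ?case using Ck_on.simps(2) by blast
qed

lemma Ck_on_local:
  assumes "\<And>x. x \<in> S \<Longrightarrow> \<exists>T. open T \<and> x \<in> T \<and> Ck_on k T f"
  shows "Ck_on k S f"
  using assms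
proof (induction k arbitrary: f)
  case 0
  show ?case
    using 0 by (simp, intro continuous_at_imp_continuous_on) (metis continuous_on_eq_continuous_at)
next
  case (Suc k)
  show ?case unfolding Ck_on.simps
  proof (intro conjI ballI allI)
    show "f differentiable at x" if "x \<in> S" for x
      using Suc.prems[OF that] by auto
    show "Ck_on k S (\<lambda>x. frechet_derivative f (at x) v)" for v
      using Suc.prems by (intro Suc.IH) fastforce
  qed
qed

lemma Ck_on_subset: "Ck_on k S f \<Longrightarrow> T \<subseteq> S \<Longrightarrow> Ck_on k T f"
  by (induction k arbitrary: f) (auto intro: continuous_on_subset)

lemma Ck_on_const: "Ck_on k S (\<lambda>x. c)"
proof (induction k arbitrary: c)
  case (Suc k)
  then show ?case by simp
qed simp

lemma Ck_on_add:
  assumes "open S" "Ck_on k S f" "Ck_on k S g"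
  shows "Ck_on k S (\<lambda>x. f x + g x)"
  using assms(2,3)
proof (induction k arbitrary: f g)
  case 0
  then show ?case by (simp add: continuous_on_add)
next
  case (Suc k)
  show ?case
    using Suc.prems
    by (intro Ck_on_SucI[OF assms(1) has_derivative_add[OF Ck_on_SucD[of k S f] Ck_on_SucD[of k S g]]] Suc.IH)
      auto
qed

lemma Ck_on_sum:
  assumes "open S" "\<And>i. i \<in> I \<Longrightarrow> Ck_on k S (f i)"
  shows "Ck_on k S (\<lambda>x. \<Sum>i\<in>I. f i x)"
  using assms(2)
  by (induction I rule: infinite_finite_induct) (auto intro: Ck_on_const Ck_on_add assms(1))

text \<open>The product rule expresses the derivative of a product through products of maps one of which
  has lost a derivative, while the other one is still \<open>C\<^sup>k\<close>; so one induction treats all bilinear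
  products at once.\<close>

lemma (in bounded_bilinear) Ck_on_bilinear:
  assumes "open S" "Ck_on k S f" "Ck_on k S g"
  shows "Ck_on k S (\<lambda>x. prod (f x) (g x))"
  using assms(2,3)
proof (induction k arbitrary: f g)
  case 0
  then show ?case by (simp add: continuous_on)
next
  case (Suc k)
  show ?case
  proof (rule Ck_on_SucI[OF assms(1) FDERIV[OF Ck_on_SucD[of k S f] Ck_on_SucD[of k S g]]])
    show "Ck_on k S (\<lambda>x. prod (f x) (frechet_derivative g (at x) v)
        + prod (frechet_derivative f (at x) v) (g x))" for v
      using Suc.prems Ck_on_Suc_imp[OF Suc.prems(1)] Ck_on_Suc_imp[OF Suc.prems(2)]
      by (intro Ck_on_add[OF assms(1)] Suc.IH) auto
  qed (use Suc.prems in auto)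
qed

lemmas Ck_on_scaleR = bounded_bilinear.Ck_on_bilinear[OF bounded_bilinear_scaleR]
lemmas Ck_on_mult = bounded_bilinear.Ck_on_bilinear[OF bounded_bilinear_mult]
lemmas Ck_on_inner = bounded_bilinear.Ck_on_bilinear[OF bounded_bilinear_inner]

lemma Ck_on_bounded_linear: "bounded_linear L \<Longrightarrow> open S \<Longrightarrow> Ck_on k S L"
proof (induction k)
  case (Suc k)
  show ?case
    by (intro Ck_on_SucI[OF Suc.prems(2) bounded_linear_imp_has_derivative[OF Suc.prems(1)]] Ck_on_const)
qed (simp add: linear_continuous_on)

text \<open>Directional derivatives are taken along fixed vectors, but the chain rule differentiates \<open>f\<close> along
  the vector \<open>Dg(x) v\<close>, which varies with \<open>x\<close>.  Expanding this vector in the standard basis turns the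
  derivative of the composite into a sum of products of maps to which the induction hypothesis applies;
  this is why the intermediate space is Euclidean.\<close>

lemma Ck_on_compose:
  fixes g :: "'b::real_normed_vector \<Rightarrow> 'd::euclidean_space"
  assumes "open S" "open T" "g ` S \<subseteq> T" "Ck_on k T f" "Ck_on k S g"
  shows "Ck_on k S (\<lambda>x. f (g x))"
  using assms(4,5)
proof (induction k arbitrary: f)
  case 0
  then show ?case using assms(3) by (auto intro: continuous_on_compose2)
next
  case (Suc k)
  let ?f' = "\<lambda>x. frechet_derivative f (at x)" and ?g' = "\<lambda>x. frechet_derivative g (at x)"
  have D: "((\<lambda>x. f (g x)) has_derivative (\<lambda>v. \<Sum>b\<in>Basis. (?g' x v \<bullet> b) *\<^sub>R ?f' (g x) b)) (at x)"
    if x: "x \<in> S" for x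
  proof -
    have f': "(f has_derivative ?f' (g x)) (at (g x))"
      using Ck_on_SucD[OF Suc.prems(1)] x assms(3) by auto
    have "?f' (g x) (?g' x v) = (\<Sum>b\<in>Basis. (?g' x v \<bullet> b) *\<^sub>R ?f' (g x) b)" for v
      by (subst euclidean_representation[symmetric])
        (simp add: linear_sum[OF has_derivative_linear[OF f']] linear_cmul[OF has_derivative_linear[OF f']])
    then show ?thesis
      using has_derivative_compose[OF Ck_on_SucD[OF Suc.prems(2) x] f'] by simp
  qed
  have "Ck_on k S (\<lambda>x. \<Sum>b\<in>Basis. (?g' x v \<bullet> b) *\<^sub>R ?f' (g x) b)" for v
    using Suc.prems Ck_on_Suc_imp[OF Suc.prems(2)]
    by (intro Ck_on_sum Ck_on_scaleR Ck_on_inner Suc.IH Ck_on_const assms(1)) auto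
  then show ?case
    by (intro Ck_on_SucI[OF assms(1) D])
qed

text \<open>The functions \<open>e\<^bsup>-1/t\<^esup> / t\<^sup>m\<close>, extended by \<open>0\<close>.  Their linear span is closed under
  differentiation, so the whole family is shown to be \<open>C\<^sup>k\<close> by one induction on \<open>k\<close>.\<close>

definition flat_exp :: "nat \<Rightarrow> real \<Rightarrow> real" where
  "flat_exp m t = (if t > 0 then exp (- 1 / t) / t ^ m else 0)"

lemma flat_exp_has_derivative:
  "(flat_exp m has_real_derivative (flat_exp (m + 2) t - real m * flat_exp (m + 1) t)) (at t)"
proof (cases t "0::real" rule: linorder_cases)
  case less
  have "((\<lambda>_. 0) has_real_derivative 0) (at t)" by simp
  then have "(flat_exp m has_real_derivative 0) (at t)"
    by (rule has_field_derivative_transform_within_open[of _ _ _ "{..<0}"])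
      (use less in \<open>auto simp: flat_exp_def\<close>)
  then show ?thesis using less by (simp add: flat_exp_def)
next
  case equal
  \<comment> \<open>At \<open>0\<close> the difference quotient vanishes on the left, and on the right the exponential beats
    every power.\<close>
  have "((\<lambda>h. flat_exp m h / h) \<longlongrightarrow> 0) (at 0)"
  proof (rule filterlim_split_at)
    have "((\<lambda>h::real. exp (- 1 / h) / h ^ m / h) \<longlongrightarrow> 0) (at_right 0)"
      by real_asymp
    then show "((\<lambda>h. flat_exp m h / h) \<longlongrightarrow> 0) (at_right 0)"
      by (rule Lim_transform_eventually) 
        (auto simp: flat_exp_def eventually_at_right_less intro: eventually_mono[OF eventually_at_right_less])
    show "((\<lambda>h. flat_exp m h / h) \<longlongrightarrow> 0) (at_left 0)"
      by (rule tendsto_eventually) (auto simp: flat_exp_def eventually_at_left_real eventually_at_filter)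
  qed
  then show ?thesis
    using equal by (simp add: has_field_derivative_iff flat_exp_def)
next
  case greater
  have "((\<lambda>t. exp (- 1 / t) / t ^ m) has_real_derivative
      (exp (- 1 / t) / t ^ (m + 2) - real m * (exp (- 1 / t) / t ^ (m + 1)))) (at t)"
    using greater
    by (auto intro!: derivative_eq_intros) (cases m; auto simp: field_simps power2_eq_square)
  then have "(flat_exp m has_real_derivative
      (exp (- 1 / t) / t ^ (m + 2) - real m * (exp (- 1 / t) / t ^ (m + 1)))) (at t)"
    by (rule has_field_derivative_transform_within_open[of _ _ _ "{0<..}"])
      (use greater in \<open>auto simp: flat_exp_def\<close>)
  then show ?thesis using greater by (simp add: flat_exp_def)
qed

lemma Ck_on_flat_exp: "Ck_on k UNIV (flat_exp m)"
proof (induction k arbitrary: m)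
  case 0
  show ?case
    using flat_exp_has_derivative by (auto intro!: DERIV_continuous_on)
next
  case (Suc k)
  have "Ck_on k UNIV (\<lambda>t. (flat_exp (m + 2) t + (- real m) * flat_exp (m + 1) t) * v)" for v
    by (intro Ck_on_mult Ck_on_add Ck_on_const Suc.IH open_UNIV)
  then show ?case
    by (intro Ck_on_SucI[OF open_UNIV flat_exp_has_derivative[unfolded has_field_derivative_def]]) simp
qed

text \<open>The argument of the flat function is positive exactly inside the ball of radius \<open>r\<close> about \<open>a\<close>, so
  \<open>bump a r\<close> is a smooth function supported in a compact ball and nonzero at its centre.\<close>

definition bump :: "'e::euclidean_space \<Rightarrow> real \<Rightarrow> 'e \<Rightarrow> real" where
  "bump a r x = flat_exp 0 (r\<^sup>2 - (x - a) \<bullet> (x - a))"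

lemma smooth_bump: "smooth_on UNIV (bump a r)"
proof -
  have id: "Ck_on k UNIV (\<lambda>x::'a. x)" for k
    by (intro Ck_on_bounded_linear bounded_linear_ident open_UNIV)
  have "Ck_on k UNIV (\<lambda>x. flat_exp 0 (r\<^sup>2 + (-1) * ((x + (- a)) \<bullet> (x + (- a)))))" for k
    by (rule Ck_on_compose[of UNIV UNIV _ _ "flat_exp 0"]) (intro open_UNIV subset_UNIV Ck_on_flat_exp
      Ck_on_add Ck_on_const Ck_on_mult Ck_on_inner id)+
  then show ?thesis by (simp add: smooth_on_def bump_def[abs_def])
qed

lemma bump_outside:
  assumes "r > 0" "x \<notin> cball a r"
  shows "bump a r x = 0"
proof -
  have "r < norm (x - a)" using assms(2) by (simp add: dist_norm norm_minus_commute)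
  then have "r\<^sup>2 < (norm (x - a))\<^sup>2" using assms(1) by (intro power_strict_mono) auto
  then show ?thesis by (simp add: bump_def flat_exp_def power2_norm_eq_inner)
qed

lemma bump_centre: "r > 0 \<Longrightarrow> bump a r a \<noteq> 0"
  by (simp add: bump_def flat_exp_def)

section \<open>Smooth functions and tangent vectors in charts\<close>

locale smooth_mfd =
  fixes M :: "('a, 'e::euclidean_space) manifold"
  assumes smooth_manifold: "smooth_manifold M"
begin

lemma
  assumes "(U, \<kappa>) \<in> charts M"
  shows chart_openin: "openin (mtop M) U"
    and chart_open_image: "open (\<kappa> ` U)"
    and chart_homeomorphic: "homeomorphic_map (subtopology (mtop M) U) (top_of_set (\<kappa> ` U)) \<kappa>"
  using smooth_manifold assms by (auto simp: smooth_manifold_def split: prod.splits)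

lemma chart_transition:
  assumes "(U, \<kappa>) \<in> charts M" "(V, \<psi>) \<in> charts M"
  shows "smooth_on (\<kappa> ` (U \<inter> V)) (\<psi> \<circ> inv_into U \<kappa>)"
  using smooth_manifold assms unfolding smooth_manifold_def by fast

lemma chart_at:
  assumes "p \<in> points M"
  obtains U \<kappa> where "(U, \<kappa>) \<in> charts M" "p \<in> U"
proof -
  have "(\<Union>(U, \<kappa>)\<in>charts M. U) = points M"
    using smooth_manifold by (simp add: smooth_manifold_def)
  with assms that show thesis by blast
qed

lemma chart_subset: "(U, \<kappa>) \<in> charts M \<Longrightarrow> U \<subseteq> points M"
  by (simp add: chart_openin openin_subset)

lemma chart_inj_on: "(U, \<kappa>) \<in> charts M \<Longrightarrow> inj_on \<kappa> U"
  using homeomorphic_imp_injective_map[OF chart_homeomorphic] chart_subset by (metis topspace_subtopology_subset)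

lemma chart_inverse: "(U, \<kappa>) \<in> charts M \<Longrightarrow> q \<in> U \<Longrightarrow> inv_into U \<kappa> (\<kappa> q) = q"
  by (simp add: chart_inj_on)

lemma chart_open_map:
  assumes "(U, \<kappa>) \<in> charts M" "openin (mtop M) W" "W \<subseteq> U"
  shows "open (\<kappa> ` W)"
proof -
  have "openin (subtopology (mtop M) U) W"
    using assms by (simp add: openin_open_subtopology chart_openin)
  then have "openin (top_of_set (\<kappa> ` U)) (\<kappa> ` W)"
    using homeomorphic_imp_open_map[OF chart_homeomorphic[OF assms(1)]] by (simp add: open_map_def)
  then show ?thesis
    using chart_open_image[OF assms(1)] by (simp add: openin_open_eq)
qed

lemma chart_overlap_open:
  assumes "(U, \<kappa>) \<in> charts M" "(V, \<psi>) \<in> charts M"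
  shows "open (\<kappa> ` (U \<inter> V))"
  using assms by (intro chart_open_map) (auto simp: chart_openin)

lemma chart_inverse_continuous:
  assumes "(U, \<kappa>) \<in> charts M"
  shows "continuous_map (top_of_set (\<kappa> ` U)) (mtop M) (inv_into U \<kappa>)"
proof -
  obtain k where k: "homeomorphic_maps (subtopology (mtop M) U) (top_of_set (\<kappa> ` U)) \<kappa> k"
    using chart_homeomorphic[OF assms] homeomorphic_map_maps by blast
  have "k y = inv_into U \<kappa> y" if "y \<in> \<kappa> ` U" for y
    using k that chart_subset[OF assms] chart_inverse[OF assms]
    by (auto simp: homeomorphic_maps_def topspace_subtopology_subset)
  with k show ?thesis
    by (auto simp: homeomorphic_maps_def continuous_map_in_subtopology intro: continuous_map_eq)
qed

text \<open>This is the place where the Hausdorff property enters: it makes the compact support of a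
  function that lives in one chart closed in the whole manifold.\<close>

lemma chart_compact_closedin:
  assumes "(U, \<kappa>) \<in> charts M" "compact C" "C \<subseteq> \<kappa> ` U"
  shows "closedin (mtop M) (U \<inter> \<kappa> -` C)"
proof -
  have "inv_into U \<kappa> ` C = U \<inter> \<kappa> -` C"
    using assms(3) chart_inverse[OF assms(1)] by (force simp: f_inv_into_f image_iff)
  moreover have "compactin (mtop M) (inv_into U \<kappa> ` C)"
    using assms by (intro image_compactin[OF _ chart_inverse_continuous])
      (auto simp: compactin_subtopology)
  ultimately show ?thesis
    using smooth_manifold by (auto simp: smooth_manifold_def intro: compactin_imp_closedin)
qed

lemma smooth_functions_iff:
  "f \<in> smooth_functions M \<longleftrightarrow> (\<forall>(U, \<kappa>)\<in>charts M. \<forall>k. Ck_on k (\<kappa> ` U) (\<lambda>x. f (inv_into U \<kappa> x)))"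
  by (simp add: smooth_functions_def smooth_on_def o_def)

lemma smooth_functionsD:
  "f \<in> smooth_functions M \<Longrightarrow> (U, \<kappa>) \<in> charts M \<Longrightarrow> Ck_on k (\<kappa> ` U) (\<lambda>x. f (inv_into U \<kappa> x))"
  using smooth_functions_iff by blast

lemma smooth_functions_cong:
  assumes "f \<in> smooth_functions M" "\<And>p. p \<in> points M \<Longrightarrow> f p = h p"
  shows "h \<in> smooth_functions M"
  unfolding smooth_functions_iff
proof (intro ballI allI, clarify)
  fix U \<kappa> k assume c: "(U, \<kappa>) \<in> charts M"
  show "Ck_on k (\<kappa> ` U) (\<lambda>x. h (inv_into U \<kappa> x))"
    by (rule Ck_on_cong[OF chart_open_image[OF c] _ smooth_functionsD[OF assms(1) c]])
      (metis assms(2) c chart_subset inv_into_into subsetD)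
qed

lemma smooth_const: "(\<lambda>_. c) \<in> smooth_functions M"
  by (auto simp: smooth_functions_iff Ck_on_const)

lemma smooth_add:
  "f \<in> smooth_functions M \<Longrightarrow> h \<in> smooth_functions M \<Longrightarrow> (\<lambda>p. f p + h p) \<in> smooth_functions M"
  by (auto simp: smooth_functions_iff chart_open_image intro!: Ck_on_add)

lemma smooth_mult:
  "f \<in> smooth_functions M \<Longrightarrow> h \<in> smooth_functions M \<Longrightarrow> (\<lambda>p. f p * h p) \<in> smooth_functions M"
  by (auto simp: smooth_functions_iff chart_open_image intro!: Ck_on_mult)

lemma smooth_diff:
  "f \<in> smooth_functions M \<Longrightarrow> h \<in> smooth_functions M \<Longrightarrow> (\<lambda>p. f p - h p) \<in> smooth_functions M"
  using smooth_add[OF _ smooth_mult[OF smooth_const[of "-1"]], of f h] by simp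

text \<open>A function with compact support in one chart stays smooth when it is extended by zero.  Near a
  point of \<open>U\<close> it is \<open>h\<close> composed with a change of charts; a point outside \<open>U\<close> has a neighbourhood that
  misses the closed set \<open>\<kappa>\<^sup>-\<^sup>1(C)\<close>, and there the function is zero.\<close>

lemma chart_extension_smooth:
  assumes c: "(U, \<kappa>) \<in> charts M" and h: "smooth_on (\<kappa> ` U) h"
    and C: "compact C" "C \<subseteq> \<kappa> ` U" and out: "\<forall>x\<in>\<kappa> ` U - C. h x = 0"
  shows "(\<lambda>q. if q \<in> U then h (\<kappa> q) else 0) \<in> smooth_functions M" (is "?F \<in> _")
  unfolding smooth_functions_iff
proof (intro ballI allI, clarify)
  fix V \<psi> k assume d: "(V, \<psi>) \<in> charts M"
  let ?i = "inv_into V \<psi>"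
  show "Ck_on k (\<psi> ` V) (\<lambda>x. ?F (?i x))"
  proof (rule Ck_on_local, clarify)
    fix q assume q: "q \<in> V"
    show "\<exists>T. open T \<and> \<psi> q \<in> T \<and> Ck_on k T (\<lambda>x. ?F (?i x))"
    proof (cases "q \<in> U")
      case True
      let ?T = "\<psi> ` (V \<inter> U)"
      have "Ck_on k ?T (\<lambda>x. h ((\<kappa> \<circ> ?i) x))"
      proof (rule Ck_on_compose[where T = "\<kappa> ` U"])
        show "(\<kappa> \<circ> ?i) ` ?T \<subseteq> \<kappa> ` U"
          using chart_inverse[OF d] by auto
        show "Ck_on k (\<kappa> ` U) h" "Ck_on k ?T (\<kappa> \<circ> ?i)"
          using h chart_transition[OF d c] by (simp_all add: smooth_on_def)
      qed (use c d chart_open_image chart_overlap_open in auto)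
      then have "Ck_on k ?T (\<lambda>x. ?F (?i x))"
        by (rule Ck_on_cong[OF chart_overlap_open[OF d c], rotated]) (auto simp: chart_inverse[OF d])
      then show ?thesis using q True chart_overlap_open[OF d c] by blast
    next
      case False
      let ?K = "U \<inter> \<kappa> -` C"
      let ?T = "\<psi> ` (V - ?K)"
      have open_T: "open ?T"
        using c d C by (intro chart_open_map[OF d]) (auto simp: chart_openin chart_compact_closedin intro: openin_diff)
      have "0 = ?F (?i x)" if "x \<in> ?T" for x
        using that bspec[OF out, of "\<kappa> (?i x)"]
        by (cases "\<kappa> (?i x) \<in> C") (auto simp: chart_inverse[OF d])
      then have "Ck_on k ?T (\<lambda>x. ?F (?i x))"
        by (rule Ck_on_cong[OF open_T _ Ck_on_const])
      then show ?thesis using q False open_T by blast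
    qed
  qed
qed

text \<open>The tangent vector at \<open>q\<close> whose coordinates in the chart \<open>(U, \<kappa>)\<close> are \<open>w\<close>.\<close>

definition chart_vector :: "'a set \<Rightarrow> ('a \<Rightarrow> 'e) \<Rightarrow> 'a \<Rightarrow> 'e \<Rightarrow> 'a tvector" where
  "chart_vector U \<kappa> q w = (\<lambda>f. if f \<in> smooth_functions M
     then frechet_derivative (\<lambda>x. f (inv_into U \<kappa> x)) (at (\<kappa> q)) w else 0)"

lemma smooth_has_derivative:
  assumes "f \<in> smooth_functions M" "(U, \<kappa>) \<in> charts M" "q \<in> U"
  shows "((\<lambda>x. f (inv_into U \<kappa> x)) has_derivative (\<lambda>w. chart_vector U \<kappa> q w f)) (at (\<kappa> q))"
  using Ck_on_SucD[OF smooth_functionsD[OF assms(1,2), of "Suc 0"], of "\<kappa> q"] assms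
  by (simp add: chart_vector_def)

lemma chart_vector_eqI:
  assumes "f \<in> smooth_functions M" "(U, \<kappa>) \<in> charts M" "q \<in> U"
    and "\<And>x. x \<in> \<kappa> ` U \<Longrightarrow> f (inv_into U \<kappa> x) = h x" "(h has_derivative h') (at (\<kappa> q))"
  shows "chart_vector U \<kappa> q w f = h' w"
proof -
  have "(h has_derivative (\<lambda>w. chart_vector U \<kappa> q w f)) (at (\<kappa> q))"
    by (rule has_derivative_transform_within_open[OF smooth_has_derivative[OF assms(1,2,3)]
      chart_open_image[OF assms(2)]]) (use assms in auto)
  then show ?thesis
    using has_derivative_unique[OF _ assms(5)] by metis
qed

lemma linear_chart_vector:
  assumes "(U, \<kappa>) \<in> charts M" "q \<in> U"
  shows "linear (chart_vector U \<kappa> q)"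
proof (rule linearI)
  have L: "linear (\<lambda>w. chart_vector U \<kappa> q w f)" for f
    using has_derivative_linear[OF smooth_has_derivative[OF _ assms]]
    by (cases "f \<in> smooth_functions M") (auto simp: chart_vector_def intro: linearI)
  show "chart_vector U \<kappa> q (v + w) = chart_vector U \<kappa> q v + chart_vector U \<kappa> q w" for v w
    by (simp add: fun_eq_iff linear_add[OF L])
  show "chart_vector U \<kappa> q (r *\<^sub>R w) = r *\<^sub>R chart_vector U \<kappa> q w" for r w
    by (simp add: fun_eq_iff linear_cmul[OF L] scaleR_fun_def)
qed

text \<open>Only the curve near time \<open>0\<close> matters, which is why the curve has to stay in \<open>U\<close> on some
  neighbourhood \<open>S\<close> of \<open>0\<close> only.\<close>

lemma velocity_eqI:
  assumes c: "(U, \<kappa>) \<in> charts M" "\<gamma> 0 \<in> U" and S: "open S" "0 \<in> S" "\<And>t. t \<in> S \<Longrightarrow> \<gamma> t \<in> U"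
    and d: "((\<lambda>t. \<kappa> (\<gamma> t)) has_derivative L) (at 0)"
  shows "velocity M \<gamma> = chart_vector U \<kappa> (\<gamma> 0) (L 1)"
proof
  fix f
  show "velocity M \<gamma> f = chart_vector U \<kappa> (\<gamma> 0) (L 1) f"
  proof (cases "f \<in> smooth_functions M")
    case True
    have "((\<lambda>t. f (inv_into U \<kappa> (\<kappa> (\<gamma> t)))) has_derivative (\<lambda>h. chart_vector U \<kappa> (\<gamma> 0) (L h) f)) (at 0)"
      by (rule has_derivative_compose[OF d smooth_has_derivative[OF True c]])
    then have *: "((\<lambda>t. f (\<gamma> t)) has_derivative (\<lambda>h. chart_vector U \<kappa> (\<gamma> 0) (L h) f)) (at 0)"
      by (rule has_derivative_transform_within_open[OF _ S(1,2)]) (simp add: S(3) chart_inverse[OF c(1)])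
    have "((\<lambda>t. f (\<gamma> t)) has_field_derivative chart_vector U \<kappa> (\<gamma> 0) (L 1) f) (at 0)"
      unfolding has_field_derivative_def
    proof (rule has_derivative_eq_rhs[OF *], rule ext)
      show "chart_vector U \<kappa> (\<gamma> 0) (L h) f = chart_vector U \<kappa> (\<gamma> 0) (L 1) f * h" for h
        using linear_cmul[OF has_derivative_linear[OF *], of h 1] by (simp add: mult.commute)
    qed
    then show ?thesis using True by (simp add: velocity_def DERIV_imp_deriv)
  qed (simp add: velocity_def chart_vector_def)
qed

lemma curve_preimage_open:
  assumes "continuous_map (top_of_set {-\<epsilon><..<\<epsilon>}) (mtop M) \<gamma>" "openin (mtop M) U"
  shows "open {t \<in> {-\<epsilon><..<\<epsilon>::real}. \<gamma> t \<in> U}"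
  using openin_continuous_map_preimage[OF assms] by (simp add: openin_open_eq)

lemma velocity_chart:
  assumes c: "(U, \<kappa>) \<in> charts M" "q \<in> U" and \<gamma>: "smooth_curve M \<epsilon> \<gamma>" "\<gamma> 0 = q"
  shows "velocity M \<gamma> \<in> range (chart_vector U \<kappa> q)"
proof -
  let ?S = "{t \<in> {-\<epsilon><..<\<epsilon>}. \<gamma> t \<in> U}"
  have "open ?S"
    using \<gamma> c by (intro curve_preimage_open) (auto simp: smooth_curve_def chart_openin)
  moreover have S: "0 \<in> ?S"
    using \<gamma> c by (auto simp: smooth_curve_def)
  moreover have "smooth_on ?S (\<kappa> \<circ> \<gamma>)"
    using \<gamma>(1) c(1) unfolding smooth_curve_def by fast
  then have "Ck_on (Suc 0) ?S (\<lambda>t. \<kappa> (\<gamma> t))"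
    unfolding smooth_on_def o_def by blast
  ultimately have "velocity M \<gamma> = chart_vector U \<kappa> (\<gamma> 0) (frechet_derivative (\<lambda>t. \<kappa> (\<gamma> t)) (at 0) 1)"
    using c \<gamma>(2) by (intro velocity_eqI[of _ _ _ ?S] Ck_on_SucD[of 0 ?S]) auto
  then show ?thesis using \<gamma>(2) by simp
qed

text \<open>The curve is the straight line through \<open>\<kappa> q\<close> with direction \<open>w\<close>, pulled back to the manifold.\<close>

lemma chart_vector_tangent:
  assumes c: "(U, \<kappa>) \<in> charts M" "q \<in> U"
  shows "chart_vector U \<kappa> q w \<in> tangent_space M q"
proof -
  obtain r where r: "r > 0" "ball (\<kappa> q) r \<subseteq> \<kappa> ` U"
    using chart_open_image[OF c(1)] c(2) by (meson imageI openE)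
  \<comment> \<open>Up to this time the line stays in the ball of radius \<open>r\<close>; the summand \<open>1\<close> covers \<open>w = 0\<close>.\<close>
  define \<epsilon> where "\<epsilon> = r / (norm w + 1)"
  define l where "l t = \<kappa> q + t *\<^sub>R w" for t
  define \<gamma> where "\<gamma> t = inv_into U \<kappa> (l t)" for t
  have \<epsilon>: "\<epsilon> > 0"
    using r(1) by (simp add: \<epsilon>_def add_nonneg_pos)
  have l_in: "l t \<in> \<kappa> ` U" if "t \<in> {-\<epsilon><..<\<epsilon>}" for t
  proof -
    have "\<bar>t\<bar> * norm w \<le> \<epsilon> * norm w"
      using that by (intro mult_right_mono) auto
    also have "\<dots> < \<epsilon> * (norm w + 1)"
      using \<epsilon> by simp
    also have "\<dots> = r"
      by (simp add: \<epsilon>_def add_nonneg_eq_0_iff)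
    finally show ?thesis
      using r(2) by (auto simp: l_def dist_norm)
  qed
  have \<gamma>_in: "\<gamma> t \<in> U" and \<kappa>_\<gamma>: "\<kappa> (\<gamma> t) = l t" if "t \<in> {-\<epsilon><..<\<epsilon>}" for t
    using l_in[OF that] by (auto simp: \<gamma>_def inv_into_into f_inv_into_f)
  have \<gamma>0: "\<gamma> 0 = q"
    using chart_inverse[OF c] by (simp add: \<gamma>_def l_def)
  have l_smooth: "Ck_on k S l" if "open S" for k S
    unfolding l_def
    by (intro Ck_on_add Ck_on_const Ck_on_bounded_linear bounded_linear_scaleR_left that)
  have \<gamma>_cont: "continuous_map (top_of_set {-\<epsilon><..<\<epsilon>}) (mtop M) \<gamma>"
    unfolding \<gamma>_def
    by (rule continuous_map_compose[OF _ chart_inverse_continuous[OF c(1)], unfolded o_def])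
      (use l_in in \<open>auto simp: l_def image_subset_iff_funcset intro!: continuous_intros\<close>)
  have "smooth_curve M \<epsilon> \<gamma>"
    unfolding smooth_curve_def
  proof (intro conjI \<epsilon> \<gamma>_cont ballI, clarify)
    fix V \<psi> assume d: "(V, \<psi>) \<in> charts M"
    let ?S = "{t \<in> {-\<epsilon><..<\<epsilon>}. \<gamma> t \<in> V}"
    have open_S: "open ?S"
      by (rule curve_preimage_open[OF \<gamma>_cont chart_openin[OF d]])
    have "Ck_on k ?S (\<lambda>t. (\<psi> \<circ> inv_into U \<kappa>) (l t))" for k
    proof (rule Ck_on_compose[OF open_S chart_overlap_open[OF c(1) d] _ _ l_smooth[OF open_S]])
      show "l ` ?S \<subseteq> \<kappa> ` (U \<inter> V)"
        using \<gamma>_in \<kappa>_\<gamma> by (force simp: image_iff)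
      show "Ck_on k (\<kappa> ` (U \<inter> V)) (\<psi> \<circ> inv_into U \<kappa>)"
        using chart_transition[OF c(1) d] by (simp add: smooth_on_def)
    qed
    then show "smooth_on ?S (\<psi> \<circ> \<gamma>)"
      by (simp add: smooth_on_def \<gamma>_def o_def)
  qed
  moreover have "((\<lambda>t. \<kappa> (\<gamma> t)) has_derivative (\<lambda>t. t *\<^sub>R w)) (at 0)"
  proof (rule has_derivative_transform_within_open[of l _ 0 UNIV "{-\<epsilon><..<\<epsilon>}"])
    show "(l has_derivative (\<lambda>t. t *\<^sub>R w)) (at 0)"
      unfolding l_def by (auto intro!: derivative_eq_intros)
  qed (use \<epsilon> \<kappa>_\<gamma> in auto)
  then have "velocity M \<gamma> = chart_vector U \<kappa> (\<gamma> 0) (1 *\<^sub>R w)"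
    using c \<gamma>0 \<gamma>_in \<epsilon> by (intro velocity_eqI[of _ _ _ "{-\<epsilon><..<\<epsilon>}"]) auto
  ultimately show ?thesis
    using \<gamma>0 unfolding tangent_space_def by (intro CollectI exI[of _ \<gamma>] exI[of _ \<epsilon>]) simp
qed

text \<open>Tangent vectors were introduced as velocities of curves, a set with no evident linear structure.
  In a chart they are the image of the linear map \<open>chart_vector\<close>; hence tangent spaces are vector
  spaces, and computations with tangent vectors become computations with Frechet derivatives.\<close>

lemma tangent_space_eq_range_chart_vector:
  assumes "(U, \<kappa>) \<in> charts M" "q \<in> U"
  shows "tangent_space M q = range (chart_vector U \<kappa> q)"
  using velocity_chart[OF assms] chart_vector_tangent[OF assms] by (auto simp: tangent_space_def)

lemma tangent_space_cases:
  assumes "q \<in> points M" "v \<in> tangent_space M q"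
  obtains U \<kappa> w where "(U, \<kappa>) \<in> charts M" "q \<in> U" "v = chart_vector U \<kappa> q w"
  using assms chart_at tangent_space_eq_range_chart_vector by (metis imageE)

lemma subspace_tangent_space:
  assumes "q \<in> points M"
  shows "subspace (tangent_space M q)"
  using assms chart_at tangent_space_eq_range_chart_vector linear_chart_vector
  by (metis linear_subspace_image subspace_UNIV)

lemma tangent_vector_const:
  assumes "q \<in> points M" "v \<in> tangent_space M q"
  shows "v (\<lambda>_. r) = 0"
  using assms
  by (elim tangent_space_cases) (auto intro: chart_vector_eqI[OF smooth_const _ _ refl has_derivative_const])

lemma tangent_vector_cong:
  assumes q: "q \<in> points M" "v \<in> tangent_space M q"
    and f: "f \<in> smooth_functions M" and eq: "\<And>x. x \<in> points M \<Longrightarrow> f x = h x"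
  shows "v f = v h"
proof -
  obtain U \<kappa> w where c: "(U, \<kappa>) \<in> charts M" "q \<in> U" and v: "v = chart_vector U \<kappa> q w"
    using tangent_space_cases[OF q] .
  have h: "h \<in> smooth_functions M"
    using smooth_functions_cong[OF f eq] .
  show ?thesis
    unfolding v
    by (rule chart_vector_eqI[OF f c _ smooth_has_derivative[OF h c]])
      (metis c(1) chart_subset eq inv_into_into subsetD)
qed

lemma vector_field_tangent: "X \<in> vector_fields M \<Longrightarrow> p \<in> points M \<Longrightarrow> X p \<in> tangent_space M p"
  by (simp add: vector_fields_def)

lemma vector_field_outside: "X \<in> vector_fields M \<Longrightarrow> p \<notin> points M \<Longrightarrow> X p = 0"
  by (simp add: vector_fields_def)

lemma vector_field_smooth:
  "X \<in> vector_fields M \<Longrightarrow> f \<in> smooth_functions M \<Longrightarrow> (\<lambda>p. X p f) \<in> smooth_functions M"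
  by (simp add: vector_fields_def)

lemma vector_field_eqI:
  assumes "X \<in> vector_fields M" "Y \<in> vector_fields M" "\<And>p. p \<in> points M \<Longrightarrow> X p = Y p"
  shows "X = Y"
  using assms vector_field_outside by (metis ext)

lemma vector_field_add:
  assumes "X \<in> vector_fields M" "Y \<in> vector_fields M"
  shows "(\<lambda>p. X p + Y p) \<in> vector_fields M"
  unfolding vector_fields_def
  using assms vector_field_outside vector_field_tangent vector_field_smooth
  by (auto intro: subspace_add[OF subspace_tangent_space] smooth_add)

lemma vector_field_scale:
  assumes "f \<in> smooth_functions M" "X \<in> vector_fields M"
  shows "(\<lambda>p. f p *\<^sub>R X p) \<in> vector_fields M"
  unfolding vector_fields_def
proof (intro CollectI conjI ballI allI impI)
  show "f p *\<^sub>R X p \<in> tangent_space M p" if "p \<in> points M" for p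
    using assms that by (simp add: subspace_scale subspace_tangent_space vector_field_tangent)
  show "(\<lambda>p. (f p *\<^sub>R X p) h) \<in> smooth_functions M" if "h \<in> smooth_functions M" for h
    using assms that by (simp add: scaleR_fun_def smooth_mult vector_field_smooth)
qed (use assms vector_field_outside in auto)

lemma vector_field_diff:
  assumes "X \<in> vector_fields M" "Y \<in> vector_fields M"
  shows "(\<lambda>p. X p - Y p) \<in> vector_fields M"
  using vector_field_add[OF assms(1) vector_field_scale[OF smooth_const[of "-1"] assms(2)]] by simp

lemma vector_field_zero: "(\<lambda>p. 0) \<in> vector_fields M"
  by (auto simp: vector_fields_def smooth_const subspace_0[OF subspace_tangent_space])

lemma vector_field_sum:
  "(\<And>i. i \<in> I \<Longrightarrow> X i \<in> vector_fields M) \<Longrightarrow> (\<lambda>p. \<Sum>i\<in>I. X i p) \<in> vector_fields M"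
  by (induction I rule: infinite_finite_induct) (auto intro: vector_field_zero vector_field_add)

section \<open>Extension of tangent vectors and tensoriality\<close>

text \<open>The coordinate vector field with constant coordinates \<open>w\<close>, cut off by a function \<open>\<beta>\<close> on the
  coordinate domain so that it extends by zero to the whole manifold.\<close>

definition cutoff_field :: "'a set \<Rightarrow> ('a \<Rightarrow> 'e) \<Rightarrow> ('e \<Rightarrow> real) \<Rightarrow> 'e \<Rightarrow> 'a vfield" where
  "cutoff_field U \<kappa> \<beta> w = (\<lambda>q. if q \<in> U then \<beta> (\<kappa> q) *\<^sub>R chart_vector U \<kappa> q w else 0)"

lemma cutoff_field:
  assumes c: "(U, \<kappa>) \<in> charts M" and \<beta>: "smooth_on (\<kappa> ` U) \<beta>"
    and C: "compact C" "C \<subseteq> \<kappa> ` U" and out: "\<forall>x\<in>\<kappa> ` U - C. \<beta> x = 0"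
  shows "cutoff_field U \<kappa> \<beta> w \<in> vector_fields M"
  unfolding vector_fields_def
proof (intro CollectI conjI ballI allI impI)
  fix p
  show "cutoff_field U \<kappa> \<beta> w p \<in> tangent_space M p" if "p \<in> points M"
    using that c by (simp add: cutoff_field_def subspace_0 subspace_scale subspace_tangent_space chart_vector_tangent)
  show "cutoff_field U \<kappa> \<beta> w p = 0" if "p \<notin> points M"
    using that chart_subset[OF c] by (auto simp: cutoff_field_def)
next
  fix f assume f: "f \<in> smooth_functions M"
  define h where "h x = \<beta> x * frechet_derivative (\<lambda>x. f (inv_into U \<kappa> x)) (at x) w" for x
  have "smooth_on (\<kappa> ` U) h"
    unfolding smooth_on_def h_def
    using \<beta> smooth_functionsD[OF f c, of "Suc _"]
    by (intro allI Ck_on_mult chart_open_image[OF c]) (auto simp: smooth_on_def)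
  then have "(\<lambda>q. if q \<in> U then h (\<kappa> q) else 0) \<in> smooth_functions M"
    by (rule chart_extension_smooth[OF c _ C]) (use out in \<open>simp add: h_def\<close>)
  then show "(\<lambda>p. cutoff_field U \<kappa> \<beta> w p f) \<in> smooth_functions M"
    by (rule smooth_functions_cong) (simp add: cutoff_field_def h_def f chart_vector_def scaleR_fun_def)
qed

lemma chart_bump:
  assumes c: "(U, \<kappa>) \<in> charts M" "p \<in> U"
  obtains \<beta> :: "'e \<Rightarrow> real" and C where "smooth_on (\<kappa> ` U) \<beta>" "\<beta> (\<kappa> p) \<noteq> 0" "compact C" "C \<subseteq> \<kappa> ` U"
    "\<forall>x\<in>\<kappa> ` U - C. \<beta> x = 0"
proof -
  obtain r where r: "r > 0" "cball (\<kappa> p) r \<subseteq> \<kappa> ` U"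
    using chart_open_image[OF c(1)] c(2) by (meson imageI open_contains_cball)
  show thesis
  proof (rule that)
    show "smooth_on (\<kappa> ` U) (bump (\<kappa> p) r)"
      using smooth_bump by (auto simp: smooth_on_def intro: Ck_on_subset)
    show "\<forall>x\<in>\<kappa> ` U - cball (\<kappa> p) r. bump (\<kappa> p) r x = 0"
      using bump_outside r(1) by blast
  qed (use r bump_centre in auto)
qed

text \<open>The cut-off coordinate field takes the prescribed value at \<open>p\<close> after \<open>w\<close> has been divided by the
  nonzero value of the bump function there.\<close>

lemma extension_field:
  assumes p: "p \<in> points M" and x: "x \<in> tangent_space M p"
  shows "extension_field M p x \<in> vector_fields M" "extension_field M p x p = x"
proof -
  obtain U \<kappa> w where c: "(U, \<kappa>) \<in> charts M" "p \<in> U" and x: "x = chart_vector U \<kappa> p w"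
    using tangent_space_cases[OF p x] .
  obtain \<beta> :: "'e \<Rightarrow> real" and C where \<beta>: "smooth_on (\<kappa> ` U) \<beta>" "\<beta> (\<kappa> p) \<noteq> 0" "compact C" "C \<subseteq> \<kappa> ` U"
    "\<forall>x\<in>\<kappa> ` U - C. \<beta> x = 0"
    using chart_bump[OF c] .
  let ?X = "cutoff_field U \<kappa> \<beta> (w /\<^sub>R \<beta> (\<kappa> p))"
  have "?X \<in> vector_fields M \<and> ?X p = x"
    using cutoff_field[OF c(1) \<beta>(1,3,4,5)] c(2) \<beta>(2)
    by (simp add: cutoff_field_def x linear_cmul[OF linear_chart_vector[OF c]])
  then have "\<exists>X. X \<in> vector_fields M \<and> X p = x" by (intro exI)
  then have "extension_field M p x \<in> vector_fields M \<and> extension_field M p x p = x"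
    unfolding extension_field_def by (rule someI_ex)
  then show "extension_field M p x \<in> vector_fields M" "extension_field M p x p = x"
    by auto
qed

text \<open>Let \<open>\<rho>\<close> be a bump function at \<open>p\<close>, let \<open>E\<^sub>b\<close> be the coordinate fields multiplied by \<open>\<rho>\<close>, and let
  \<open>u\<^sub>b\<close> be the coordinate functions multiplied by \<open>\<rho>\<close>.  All of these are globally defined and smooth, and
  \<open>\<rho>\<^sup>3 X = \<Sum>\<^sub>b a\<^sub>b E\<^sub>b\<close> with \<open>a\<^sub>b = \<rho> X(u\<^sub>b) - u\<^sub>b X(\<rho>)\<close>,
  because \<open>a\<^sub>b\<close> is \<open>\<rho>\<^sup>2\<close> times the \<open>b\<close>-th coordinate of \<open>X\<close> by the product rule.  If \<open>X\<close> vanishes at \<open>p\<close>, then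
  so do all \<open>a\<^sub>b\<close>, and applying \<open>A\<close> to both sides gives \<open>\<rho>(p)\<^sup>3 A X = 0\<close>.\<close>

lemma tensoriality_zero:
  fixes A :: "'a vfield \<Rightarrow> 'c::real_vector"
  assumes p: "p \<in> points M" and X: "X \<in> vector_fields M" "X p = 0"
    and add: "\<And>X Y. X \<in> vector_fields M \<Longrightarrow> Y \<in> vector_fields M \<Longrightarrow> A (\<lambda>q. X q + Y q) = A X + A Y"
    and scale: "\<And>f X. f \<in> smooth_functions M \<Longrightarrow> X \<in> vector_fields M \<Longrightarrow> A (\<lambda>q. f q *\<^sub>R X q) = f p *\<^sub>R A X"
  shows "A X = 0"
proof -
  obtain U \<kappa> where c: "(U, \<kappa>) \<in> charts M" "p \<in> U"
    using chart_at[OF p] .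
  obtain \<beta> :: "'e \<Rightarrow> real" and C where \<beta>: "smooth_on (\<kappa> ` U) \<beta>" "\<beta> (\<kappa> p) \<noteq> 0" "compact C" "C \<subseteq> \<kappa> ` U"
    "\<forall>x\<in>\<kappa> ` U - C. \<beta> x = 0"
    using chart_bump[OF c] .
  define \<rho> where "\<rho> q = (if q \<in> U then \<beta> (\<kappa> q) else 0)" for q
  define u where "u b q = (if q \<in> U then \<beta> (\<kappa> q) * (\<kappa> q \<bullet> b) else 0)" for b q
  define a where "a b q = \<rho> q * X q (u b) - u b q * X q \<rho>" for b q
  define E where "E b = cutoff_field U \<kappa> \<beta> b" for b
  have \<rho>: "\<rho> \<in> smooth_functions M"
    unfolding \<rho>_def[abs_def] using \<beta> by (intro chart_extension_smooth[OF c(1), of _ C]) auto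
  have "Ck_on k (\<kappa> ` U) (\<lambda>x. \<beta> x * (x \<bullet> b))" for k b
    by (rule Ck_on_mult[OF chart_open_image[OF c(1)] \<beta>(1)[unfolded smooth_on_def, rule_format]
      Ck_on_bounded_linear[OF bounded_linear_inner_left chart_open_image[OF c(1)]]])
  then have u: "u b \<in> smooth_functions M" for b
    unfolding u_def[abs_def] using \<beta>
    by (intro chart_extension_smooth[OF c(1), of "\<lambda>x. \<beta> x * (x \<bullet> b)" C]) (auto simp: smooth_on_def)
  have a: "a b \<in> smooth_functions M" for b
    unfolding a_def[abs_def] by (intro smooth_diff smooth_mult vector_field_smooth[OF X(1)] \<rho> u)
  have E: "E b \<in> vector_fields M" for b
    unfolding E_def by (intro cutoff_field[OF c(1) \<beta>(1,3,4,5)])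
  have "(\<rho> q) ^ 3 *\<^sub>R X q = (\<Sum>b\<in>Basis. a b q *\<^sub>R E b q)" for q
  proof (cases "q \<in> U")
    case True
    note d = c(1) True
    obtain w where w: "X q = chart_vector U \<kappa> q w"
      using vector_field_tangent[OF X(1), of q] tangent_space_eq_range_chart_vector[OF d] chart_subset[OF c(1)] True
      by auto
    obtain \<beta>' where \<beta>': "(\<beta> has_derivative \<beta>') (at (\<kappa> q))"
      using Ck_on_SucD[of 0 "\<kappa> ` U" \<beta> "\<kappa> q"] \<beta>(1) True unfolding smooth_on_def by blast
    have 1: "X q \<rho> = \<beta>' w"
      unfolding w using d(1)
      by (intro chart_vector_eqI[OF \<rho> d _ \<beta>']) (auto simp: \<rho>_def chart_inverse)
    have "((\<lambda>x. x \<bullet> b) has_derivative (\<lambda>w. w \<bullet> b)) (at (\<kappa> q))" for b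
      by (intro bounded_linear_imp_has_derivative bounded_linear_inner_left)
    then have 2: "X q (u b) = \<beta> (\<kappa> q) * (w \<bullet> b) + \<beta>' w * (\<kappa> q \<bullet> b)" for b
      unfolding w using d(1)
      by (intro chart_vector_eqI[OF u d _ has_derivative_mult[OF \<beta>']]) (auto simp: u_def chart_inverse)
    have 3: "a b q = (\<beta> (\<kappa> q))\<^sup>2 * (w \<bullet> b)" for b
      unfolding a_def 1 2 using True by (simp add: \<rho>_def u_def algebra_simps power2_eq_square)
    have "X q = (\<Sum>b\<in>Basis. (w \<bullet> b) *\<^sub>R chart_vector U \<kappa> q b)"
      unfolding w by (subst euclidean_representation[of w, symmetric])
        (simp only: linear_sum[OF linear_chart_vector[OF d]] linear_cmul[OF linear_chart_vector[OF d]])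
    then have "(\<rho> q) ^ 3 *\<^sub>R X q = (\<Sum>b\<in>Basis. (\<rho> q) ^ 3 *\<^sub>R (w \<bullet> b) *\<^sub>R chart_vector U \<kappa> q b)"
      by (simp only: scaleR_sum_right)
    also have "\<dots> = (\<Sum>b\<in>Basis. a b q *\<^sub>R E b q)"
      using True by (intro sum.cong refl)
        (simp add: 3 E_def cutoff_field_def \<rho>_def power3_eq_cube power2_eq_square algebra_simps)
    finally show ?thesis .
  next
    case False
    then show ?thesis by (simp add: \<rho>_def E_def cutoff_field_def)
  qed
  then have eq: "(\<lambda>q. (\<rho> q) ^ 3 *\<^sub>R X q) = (\<lambda>q. \<Sum>b\<in>Basis. a b q *\<^sub>R E b q)"
    by blast
  have zero: "A (\<lambda>q. 0) = 0"
    using scale[OF smooth_const[of 0] X(1)] by simp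
  have A_sum: "A (\<lambda>q. \<Sum>b\<in>I. a b q *\<^sub>R E b q) = (\<Sum>b\<in>I. a b p *\<^sub>R A (E b))" for I
    by (induction I rule: infinite_finite_induct)
      (simp_all only: sum.infinite sum.empty sum.insert zero add scale vector_field_sum vector_field_scale a E
        not_False_eq_True)
  have "(\<lambda>q. (\<rho> q) ^ 3) \<in> smooth_functions M"
    unfolding power3_eq_cube by (intro smooth_mult \<rho>)
  then have "(\<rho> p) ^ 3 *\<^sub>R A X = A (\<lambda>q. \<Sum>b\<in>Basis. a b q *\<^sub>R E b q)"
    unfolding eq[symmetric] by (rule scale[symmetric, OF _ X(1)])
  also have "\<dots> = 0"
    unfolding A_sum by (simp add: a_def X(2))
  finally show ?thesis
    using \<beta>(2) c(2) by (simp add: \<rho>_def)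
qed

lemma tensoriality:
  fixes A :: "'a vfield \<Rightarrow> 'c::real_vector"
  assumes p: "p \<in> points M" and X: "X \<in> vector_fields M" "Y \<in> vector_fields M" "X p = Y p"
    and add: "\<And>X Y. X \<in> vector_fields M \<Longrightarrow> Y \<in> vector_fields M \<Longrightarrow> A (\<lambda>q. X q + Y q) = A X + A Y"
    and scale: "\<And>f X. f \<in> smooth_functions M \<Longrightarrow> X \<in> vector_fields M \<Longrightarrow> A (\<lambda>q. f q *\<^sub>R X q) = f p *\<^sub>R A X"
  shows "A X = A Y"
proof -
  let ?Z = "\<lambda>q. X q + (-1) *\<^sub>R Y q"
  note Y' = vector_field_scale[OF smooth_const[of "-1"] X(2)]
  have "A ?Z = 0"
    by (rule tensoriality_zero[where A = A, OF p vector_field_add[OF X(1) Y'] _ add scale]) (simp_all add: X(3))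
  then show ?thesis
    using add[OF X(1) Y'] scale[OF smooth_const[of "-1"] X(2)] by simp
qed

end

section \<open>Linear algebra of an almost contact B-metric space\<close>

context
  fixes V :: "'v::real_vector set" and f :: "'v \<Rightarrow> 'w::real_vector"
  assumes V: "subspace V" and f: "linear_map_on V f"
begin

lemma linear_map_on_add: "x \<in> V \<Longrightarrow> y \<in> V \<Longrightarrow> f (x + y) = f x + f y"
  using f[unfolded linear_map_on_def, rule_format, of x y 1 1] by simp

lemma linear_map_on_scale: "x \<in> V \<Longrightarrow> f (r *\<^sub>R x) = r *\<^sub>R f x"
  using f[unfolded linear_map_on_def, rule_format, of x x r 0] by simp

lemma linear_map_on_zero: "f 0 = 0"
  using linear_map_on_scale[OF subspace_0[OF V], of 0] by simp

lemma linear_map_on_uminus: "x \<in> V \<Longrightarrow> f (- x) = - f x"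
  using linear_map_on_scale[of x "-1"] by simp

lemma linear_map_on_diff: "x \<in> V \<Longrightarrow> y \<in> V \<Longrightarrow> f (x - y) = f x - f y"
  using f[unfolded linear_map_on_def, rule_format, of x y 1 "-1"] by simp

lemma linear_map_on_sum: "(\<And>i. i \<in> I \<Longrightarrow> x i \<in> V) \<Longrightarrow> f (\<Sum>i\<in>I. x i) = (\<Sum>i\<in>I. f (x i))"
  by (induction I rule: infinite_finite_induct) (auto simp: linear_map_on_zero linear_map_on_add subspace_sum[OF V])

end

lemmas linear_map_on_simps =
  linear_map_on_add linear_map_on_scale linear_map_on_zero linear_map_on_uminus linear_map_on_diff

lemma linear_imp_linear_map_on: "linear f \<Longrightarrow> linear_map_on V f"
  by (simp add: linear_map_on_def linear_add linear_cmul)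

lemma metric_trace_add: "metric_trace H g (\<lambda>x y. S x y + T x y) = metric_trace H g S + metric_trace H g T"
  by (simp add: metric_trace_def Let_def distrib_left sum.distrib)

lemma metric_trace_scale: "metric_trace H g (\<lambda>x y. r * T x y) = r * metric_trace H g T"
  by (simp add: metric_trace_def Let_def sum_distrib_left mult.left_commute)

lemma metric_trace_cong:
  assumes "subspace H" "\<And>x y. x \<in> H \<Longrightarrow> y \<in> H \<Longrightarrow> S x y = T x y"
  shows "metric_trace H g S = metric_trace H g T"
proof -
  have "\<exists>B. independent B \<and> span B = H"
    using basis_exists[of H] span_subspace[OF _ _ assms(1)] by metis
  then have "(SOME B. independent B \<and> span B = H) \<subseteq> H"
    by (metis (mono_tags, lifting) someI_ex span_superset)
  then show ?thesis
    unfolding metric_trace_def Let_def using assms(2) by (intro sum.cong refl) (simp add: subset_iff)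
qed

locale almost_contact_B_space =
  fixes V :: "'v::real_vector set" and n :: nat and \<phi> :: "'v \<Rightarrow> 'v" and \<xi> :: 'v
    and \<eta> :: "'v \<Rightarrow> real" and g :: "'v \<Rightarrow> 'v \<Rightarrow> real"
  assumes V: "subspace V" and n: "n \<ge> 1"
    and \<phi>_linear: "linear_map_on V \<phi>" and \<phi>_V: "x \<in> V \<Longrightarrow> \<phi> x \<in> V"
    and \<xi>_V: "\<xi> \<in> V" and \<eta>_linear: "linear_map_on V \<eta>"
    and g_linear: "x \<in> V \<Longrightarrow> linear_map_on V (g x)"
    and g_sym: "x \<in> V \<Longrightarrow> y \<in> V \<Longrightarrow> g x y = g y x"
    and signature: "has_signature V g (n + 1) n"
    and \<phi>_\<xi>: "\<phi> \<xi> = 0" and \<eta>_\<xi>: "\<eta> \<xi> = 1"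
    and \<phi>_\<phi>: "x \<in> V \<Longrightarrow> \<phi> (\<phi> x) = - x + \<eta> x *\<^sub>R \<xi>"
    and \<eta>_\<phi>: "x \<in> V \<Longrightarrow> \<eta> (\<phi> x) = 0"
    and g_\<phi>_\<phi>: "x \<in> V \<Longrightarrow> y \<in> V \<Longrightarrow> g (\<phi> x) (\<phi> y) = - g x y + \<eta> x * \<eta> y"
begin

abbreviation H :: "'v set" where "H \<equiv> ker_on V \<eta>"

lemmas V_closed = subspace_add[OF V] subspace_diff[OF V] subspace_scale[OF V] subspace_neg[OF V]
  subspace_0[OF V] \<xi>_V \<phi>_V

lemma g_linear_left:
  assumes x: "x \<in> V"
  shows "linear_map_on V (\<lambda>w. g w x)"
  unfolding linear_map_on_def
proof (intro ballI allI)
  fix u v a b assume uv: "u \<in> V" "v \<in> V"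
  have "g (a *\<^sub>R u + b *\<^sub>R v) x = g x (a *\<^sub>R u + b *\<^sub>R v)"
    using uv x by (simp add: g_sym[of _ x] V_closed)
  also have "\<dots> = a *\<^sub>R g u x + b *\<^sub>R g v x"
    using g_linear[OF x] uv by (simp add: linear_map_on_def g_sym[OF x])
  finally show "g (a *\<^sub>R u + b *\<^sub>R v) x = a *\<^sub>R g u x + b *\<^sub>R g v x" .
qed

lemmas \<phi>_simps = linear_map_on_simps[OF V \<phi>_linear]
lemmas \<eta>_simps = linear_map_on_simps[OF V \<eta>_linear]
lemmas g_simps = linear_map_on_simps[OF V g_linear] linear_map_on_simps[OF V g_linear_left]

lemma g_\<xi>: "x \<in> V \<Longrightarrow> g x \<xi> = \<eta> x"
  using g_\<phi>_\<phi>[OF _ \<xi>_V] by (simp add: \<phi>_\<xi> \<eta>_\<xi> g_simps V_closed)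

lemma g_\<phi>_self_adjoint:
  assumes "x \<in> V" "y \<in> V"
  shows "g (\<phi> x) y = g x (\<phi> y)"
  using g_\<phi>_\<phi>[of x "\<phi> y"] assms
  by (simp add: \<eta>_\<phi> V_closed \<phi>_\<phi> g_simps g_\<xi>)

lemma H_imp_V: "x \<in> H \<Longrightarrow> x \<in> V"
  by (simp add: ker_on_def)

lemma subspace_H: "subspace H"
  unfolding subspace_def by (auto simp: ker_on_def V_closed \<eta>_simps)

text \<open>For an orthonormal basis \<open>E\<close>, the vector \<open>u\<close> is \<open>\<Sum>\<^sub>e g(e,e) f(e) e\<close>: the factors \<open>g(e,e) = \<plusminus>1\<close>
  compensate the signature.\<close>

lemma metric_Riesz:
  assumes f: "linear_map_on V f"
  shows "\<exists>u\<in>V. \<forall>y\<in>V. g u y = (f y :: real)"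
proof -
  obtain P N where PN: "finite P" "finite N" "span (P \<union> N) = V"
    "\<forall>x\<in>P. g x x = 1" "\<forall>x\<in>N. g x x = -1" "\<forall>x\<in>P \<union> N. \<forall>y\<in>P \<union> N. x \<noteq> y \<longrightarrow> g x y = 0"
    using signature unfolding has_signature_def by (elim exE conjE) (rule that; assumption)
  let ?E = "P \<union> N"
  define u where "u = (\<Sum>e\<in>?E. (g e e * f e) *\<^sub>R e)"
  have E_V: "e \<in> V" if "e \<in> ?E" for e
    using that span_superset[of ?E] PN(3) by blast
  then have u: "u \<in> V"
    unfolding u_def by (intro subspace_sum[OF V] V_closed)
  have basis: "g u e = f e" if e: "e \<in> ?E" for e
  proof -
    have "g u e = (\<Sum>d\<in>?E. g d d * f d * g d e)"
    proof -
      note lin = g_linear_left[OF E_V[OF e]]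
      have "g u e = (\<Sum>d\<in>?E. g ((g d d * f d) *\<^sub>R d) e)"
        unfolding u_def by (rule linear_map_on_sum[OF V lin]) (intro V_closed E_V)
      also have "\<dots> = (\<Sum>d\<in>?E. g d d * f d * g d e)"
        by (intro sum.cong refl) (simp only: linear_map_on_scale[OF V lin E_V] real_scaleR_def)
      finally show ?thesis .
    qed
    also have "\<dots> = (\<Sum>d\<in>?E. if d = e then f e else 0)"
      using PN e by (intro sum.cong) auto
    also have "\<dots> = f e"
      using PN e by simp
    finally show ?thesis .
  qed
  have "subspace {y \<in> V. g u y = f y}"
    unfolding subspace_def
    by (auto simp: V_closed g_simps u linear_map_on_simps[OF V f])
  then have "span ?E \<subseteq> {y \<in> V. g u y = f y}"
    using basis E_V by (intro span_minimal) auto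
  then show ?thesis using u PN(3) by blast
qed

text \<open>A nonzero \<open>u\<close> is detected by some linear functional, and every functional is pairing with some vector.\<close>

lemma g_nondegenerate:
  assumes u: "u \<in> V" "\<And>y. y \<in> V \<Longrightarrow> g u y = 0"
  shows "u = 0"
proof (rule ccontr)
  assume "u \<noteq> 0"
  then have "independent {u}" by simp
  then obtain f :: "'v \<Rightarrow> real" where f: "linear f" "f u = 1"
    using linear_independent_extend[of "{u}" "\<lambda>_. 1 :: real"] by auto
  obtain v where v: "v \<in> V" "g v u = 1"
    using metric_Riesz[OF linear_imp_linear_map_on[OF f(1)]] u(1) f(2) by auto
  then show False
    using u(2)[OF v(1)] g_sym[OF v(1) u(1)] by simp
qed

lemma horizontal_basis:
  assumes B: "independent B" "span B = H"
  shows "finite B" "card B = 2 * n" "independent (insert \<xi> B)"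
proof -
  have "\<xi> \<notin> span B"
    by (simp add: B ker_on_def \<eta>_\<xi>)
  then show ind: "independent (insert \<xi> B)"
    using B(1) by (simp add: independent_insert)
  have span: "span (insert \<xi> B) = V"
  proof (intro set_eqI iffI)
    fix x
    assume "x \<in> span (insert \<xi> B)"
    then show "x \<in> V"
      using span_minimal[OF _ V, of "insert \<xi> B"] span_superset[of B] H_imp_V \<xi>_V B(2) by blast
  next
    fix x assume "x \<in> V"
    then show "x \<in> span (insert \<xi> B)"
      unfolding span_breakdown_eq B by (intro exI[of _ "\<eta> x"]) (simp add: ker_on_def V_closed \<eta>_simps \<eta>_\<xi>)
  qed
  obtain E where E: "finite E" "card E = 2 * n + 1" "independent E" "span E = V"
    using signature card_Un_disjoint unfolding has_signature_def
    by (metis (no_types, lifting) finite_UnI mult_2 add.commute add.assoc)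
  have fin: "finite (insert \<xi> B)"
    using independent_span_bound[OF E(1) ind] span E(4) span_superset[of "insert \<xi> B"] by simp
  then show "finite B" by simp
  have "card (insert \<xi> B) = card E"
    using dim_span_eq_card_independent[OF ind] dim_span_eq_card_independent[OF E(3)] span E(4) by simp
  then show "card B = 2 * n"
    using fin \<open>\<xi> \<notin> span B\<close> span_base E(2) by (metis Suc_eq_plus1 card_insert_disjoint diff_Suc_1 finite_insert)
qed

text \<open>Row \<open>a\<close> of the inverse Gram matrix consists of the coordinates of the vector \<open>u\<close> with \<open>g(u,c) = \<delta>\<^sub>a\<^sub>c\<close>
  on \<open>B\<close> and \<open>g(u,\<xi>) = 0\<close>.  The second condition puts \<open>u\<close> into \<open>H = span B\<close>, so that these coordinates
  exist.\<close>

lemma inverse_matrix: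
  assumes B: "independent B" "span B = H" and "a \<in> B" "c \<in> B"
  shows "(\<Sum>b\<in>B. inverse_matrix_on B g a b * g b c) = (if a = c then 1 else 0)"
proof -
  note hb = horizontal_basis[OF B]
  have B_V: "b \<in> V" if "b \<in> B" for b
    using that B(2) span_superset[of B] H_imp_V by blast
  have "\<exists>r. \<forall>c\<in>B. (\<Sum>b\<in>B. r b * g b c) = (if a = c then 1 else 0)" if a: "a \<in> B" for a
  proof -
    obtain f :: "'v \<Rightarrow> real" where f: "linear f" "\<forall>x\<in>insert \<xi> B. f x = (if x = a then 1 else 0)"
      using linear_independent_extend[OF hb(3), of "\<lambda>x. if x = a then 1 else 0 :: real"] by blast
    obtain u where u: "u \<in> V" "\<And>y. y \<in> V \<Longrightarrow> g u y = f y"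
      using metric_Riesz[OF linear_imp_linear_map_on[OF f(1)]] by blast
    have "a \<noteq> \<xi>"
      using a B(2) span_superset[of B] by (auto simp: ker_on_def \<eta>_\<xi>)
    then have "u \<in> span B"
      using u f(2) g_\<xi>[OF u(1)] \<xi>_V B(2) by (simp add: ker_on_def)
    then obtain r where r: "u = (\<Sum>b\<in>B. r b *\<^sub>R b)"
      using span_finite[OF hb(1)] by auto
    have "(\<Sum>b\<in>B. r b * g b c) = f c" if c: "c \<in> B" for c
    proof -
      have "f c = g u c" using u(2) B_V c by simp
      also have "\<dots> = (\<Sum>b\<in>B. r b * g b c)"
        unfolding r by (subst linear_map_on_sum[OF V g_linear_left[OF B_V[OF c]]])
          (simp_all add: g_simps V_closed B_V c)
      finally show ?thesis by simp
    qed
    then show ?thesis using f(2) by (intro exI[of _ r]) auto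
  qed
  then have "\<exists>G. \<forall>a\<in>B. \<forall>c\<in>B. (\<Sum>b\<in>B. G a b * g b c) = (if a = c then 1 else 0)"
    by (intro bchoice ballI)
  from someI_ex[OF this] show ?thesis
    using assms(3,4) unfolding inverse_matrix_on_def by blast
qed

lemma metric_trace_metric: "metric_trace H g g = 2 * real n"
proof -
  define B where "B = (SOME B. independent B \<and> span B = H)"
  have "\<exists>B. independent B \<and> span B = H"
    using basis_exists[of H] span_subspace[OF _ _ subspace_H] by metis
  then have B: "independent B" "span B = H"
    unfolding B_def by (metis (mono_tags, lifting) someI_ex)+
  have B_V: "b \<in> V" if "b \<in> B" for b
    using that B(2) span_superset[of B] H_imp_V by blast
  have "(\<Sum>b\<in>B. inverse_matrix_on B g a b * g a b) = 1" if "a \<in> B" for a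
    using inverse_matrix[OF B that that] g_sym B_V that by (simp cong: sum.cong)
  then have "metric_trace H g g = real (card B)"
    by (simp add: metric_trace_def Let_def B_def[symmetric])
  then show ?thesis by (simp add: horizontal_basis[OF B])
qed

section \<open>The class \<open>U\<^sub>2\<close> is the space of vertical tensors\<close>

definition bilinear_form :: "('v \<Rightarrow> 'v \<Rightarrow> real) \<Rightarrow> bool" where
  "bilinear_form T \<longleftrightarrow> (\<forall>x\<in>V. linear_map_on V (T x) \<and> linear_map_on V (\<lambda>w. T w x))"

text \<open>A vertical tensor \<open>F\<close> is determined by the bilinear form \<open>(x,y) \<mapsto> F(x,y,\<xi>)\<close>; this is the inverse
  construction, with the value \<open>0\<close> outside \<open>V\<close> that membership in \<^const>\<open>F_space\<close> prescribes.\<close>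

definition vertical_extension :: "('v \<Rightarrow> 'v \<Rightarrow> real) \<Rightarrow> 'v \<Rightarrow> 'v \<Rightarrow> 'v \<Rightarrow> real" where
  "vertical_extension T = (\<lambda>x y z. if x \<in> V \<and> y \<in> V \<and> z \<in> V then T x y * \<eta> z + T x z * \<eta> y else 0)"

lemma bilinear_form_right: "bilinear_form T \<Longrightarrow> z \<in> V \<Longrightarrow> linear_map_on V (T z)"
  and bilinear_form_left: "bilinear_form T \<Longrightarrow> z \<in> V \<Longrightarrow> linear_map_on V (\<lambda>w. T w z)"
  by (simp_all add: bilinear_form_def)

lemmas bilinear_form_simps =
  linear_map_on_simps[OF V bilinear_form_right] linear_map_on_simps[OF V bilinear_form_left]

lemma bilinear_form_add: "bilinear_form S \<Longrightarrow> bilinear_form T \<Longrightarrow> bilinear_form (\<lambda>x y. S x y + T x y)"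
  by (simp add: bilinear_form_def linear_map_on_def algebra_simps)

lemma bilinear_form_scale: "bilinear_form T \<Longrightarrow> bilinear_form (\<lambda>x y. r * T x y)"
  by (simp add: bilinear_form_def linear_map_on_def algebra_simps)

lemma bilinear_form_swap: "bilinear_form T \<Longrightarrow> bilinear_form (\<lambda>x y. T y x)"
  by (simp add: bilinear_form_def)

lemma bilinear_form_\<phi>: "bilinear_form T \<Longrightarrow> bilinear_form (\<lambda>x y. T x (\<phi> y))"
  unfolding bilinear_form_def linear_map_on_def by (simp add: V_closed \<phi>_simps)

lemma bilinear_form_metric: "bilinear_form g"
  by (simp add: bilinear_form_def g_linear g_linear_left)

lemma vertical_F_space_imp: "F \<in> vertical_F_space V \<phi> \<xi> \<eta> \<Longrightarrow> F \<in> F_space V \<phi> \<xi> \<eta>"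
  by (simp add: vertical_F_space_def)

lemma vertical_extension:
  assumes T: "bilinear_form T" and T_\<xi>: "\<And>x. x \<in> V \<Longrightarrow> T x \<xi> = 0"
  shows "vertical_extension T \<in> vertical_F_space V \<phi> \<xi> \<eta>"
proof -
  let ?F = "vertical_extension T"
  have F: "?F x y z = T x y * \<eta> z + T x z * \<eta> y" if "x \<in> V" "y \<in> V" "z \<in> V" for x y z
    using that by (simp add: vertical_extension_def)
  have "linear_map_on V (\<lambda>w. ?F w x y)" "linear_map_on V (\<lambda>w. ?F x w y)"
    "linear_map_on V (\<lambda>w. ?F x y w)" if "x \<in> V" "y \<in> V" for x y
    using that unfolding linear_map_on_def
    by (simp_all add: F V_closed \<eta>_simps bilinear_form_simps[OF T] algebra_simps)
  moreover have "?F x y z = ?F x z y"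
    "?F x y z = ?F x (\<phi> y) (\<phi> z) + \<eta> y * ?F x \<xi> z + \<eta> z * ?F x y \<xi>"
    "?F x y z = ?F x y \<xi> * \<eta> z + ?F x z \<xi> * \<eta> y" if "x \<in> V" "y \<in> V" "z \<in> V" for x y z
    using that by (simp_all add: F V_closed \<eta>_\<phi> \<eta>_\<xi> T_\<xi>)
  ultimately show ?thesis
    unfolding vertical_F_space_def F_space_def by (auto simp: vertical_extension_def)
qed

lemma vertical_extension_\<xi>:
  "x \<in> V \<Longrightarrow> y \<in> V \<Longrightarrow> T x \<xi> = 0 \<Longrightarrow> vertical_extension T x y \<xi> = T x y"
  by (simp add: vertical_extension_def \<xi>_V \<eta>_\<xi>)

lemma vertical_extension_add:
  "vertical_extension (\<lambda>x y. S x y + T x y) = vertical_extension S + vertical_extension T"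
  by (simp add: vertical_extension_def fun_eq_iff algebra_simps)

lemma vertical_extension_cong:
  "(\<And>x y. x \<in> V \<Longrightarrow> y \<in> V \<Longrightarrow> S x y = T x y) \<Longrightarrow> vertical_extension S = vertical_extension T"
  by (simp add: vertical_extension_def fun_eq_iff)

lemma vertical_F_space_eq_extension:
  assumes F: "F \<in> vertical_F_space V \<phi> \<xi> \<eta>"
  shows "F = vertical_extension (\<lambda>x y. F x y \<xi>)" "bilinear_form (\<lambda>x y. F x y \<xi>)"
    "x \<in> V \<Longrightarrow> F x \<xi> \<xi> = 0"
proof -
  show "F = vertical_extension (\<lambda>x y. F x y \<xi>)"
  proof (intro ext)
    fix x y z
    show "F x y z = vertical_extension (\<lambda>x y. F x y \<xi>) x y z"
    proof (cases "x \<in> V \<and> y \<in> V \<and> z \<in> V")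
      case True
      then have "F x y z = F x y \<xi> * \<eta> z + F x z \<xi> * \<eta> y"
        using F unfolding vertical_F_space_def by blast
      then show ?thesis using True by (simp add: vertical_extension_def)
    next
      case False
      then have "F x y z = 0"
        using F unfolding vertical_F_space_def F_space_def by blast
      then show ?thesis using False by (auto simp: vertical_extension_def)
    qed
  qed
  show "bilinear_form (\<lambda>x y. F x y \<xi>)"
    using F \<xi>_V unfolding vertical_F_space_def F_space_def bilinear_form_def by blast
  show "F x \<xi> \<xi> = 0" if "x \<in> V"
    using F \<xi>_V that \<eta>_\<xi> unfolding vertical_F_space_def by fastforce
qed

lemma vertical_F_space_add:
  assumes "F \<in> vertical_F_space V \<phi> \<xi> \<eta>" "G \<in> vertical_F_space V \<phi> \<xi> \<eta>"
  shows "F + G \<in> vertical_F_space V \<phi> \<xi> \<eta>"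
proof -
  note F = vertical_F_space_eq_extension[OF assms(1)]
  note G = vertical_F_space_eq_extension[OF assms(2)]
  have "F + G = vertical_extension (\<lambda>x y. F x y \<xi> + G x y \<xi>)"
    using F(1) G(1) vertical_extension_add by metis
  also have "\<dots> \<in> vertical_F_space V \<phi> \<xi> \<eta>"
    using F(3) G(3) by (intro vertical_extension bilinear_form_add F(2) G(2)) simp
  finally show ?thesis .
qed

text \<open>On \<open>H\<close> the summand with \<open>\<eta>(y)\<close> disappears, so the traces \<open>\<theta>\<close> and \<open>\<theta>\<^sup>*\<close> of a vertical tensor are
  traces of its bilinear form.\<close>

lemma theta_vertical_extension:
  "z \<in> V \<Longrightarrow> theta V \<eta> g (vertical_extension T) z = \<eta> z * metric_trace H g T"
  unfolding theta_def metric_trace_scale[symmetric]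
  by (intro metric_trace_cong[OF subspace_H]) (simp add: vertical_extension_def ker_on_def)

lemma theta_star_vertical_extension:
  "z \<in> V \<Longrightarrow> theta_star V \<phi> \<eta> g (vertical_extension T) z = \<eta> z * metric_trace H g (\<lambda>x y. T x (\<phi> y))"
  unfolding theta_star_def metric_trace_scale[symmetric]
  by (intro metric_trace_cong[OF subspace_H]) (simp add: vertical_extension_def ker_on_def \<eta>_\<phi> \<phi>_V)

text \<open>In each class \<open>F(x,\<xi>,\<xi>) = 0\<close>, and the defining formula is already of the shape
  \<open>T(x,y)\<eta>(z) + T(x,z)\<eta>(y)\<close>.\<close>

lemma class_U2_subset: "class_U2 V n \<phi> \<xi> \<eta> g \<subseteq> vertical_F_space V \<phi> \<xi> \<eta>"
proof -
  have "class_F4 V n \<phi> \<xi> \<eta> g \<subseteq> vertical_F_space V \<phi> \<xi> \<eta>"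
  proof
    fix F assume F: "F \<in> class_F4 V n \<phi> \<xi> \<eta> g"
    then obtain c where "F x y z = c * (g (\<phi> x) (\<phi> y) * \<eta> z + g (\<phi> x) (\<phi> z) * \<eta> y)"
      if "x \<in> V" "y \<in> V" "z \<in> V" for x y z
      unfolding class_F4_def by blast
    then show "F \<in> vertical_F_space V \<phi> \<xi> \<eta>"
      using F by (simp add: vertical_F_space_def class_F4_def \<xi>_V \<eta>_\<xi> \<phi>_\<xi> g_simps V_closed algebra_simps)
  qed
  moreover have "class_F5 V n \<phi> \<xi> \<eta> g \<subseteq> vertical_F_space V \<phi> \<xi> \<eta>"
  proof
    fix F assume F: "F \<in> class_F5 V n \<phi> \<xi> \<eta> g"
    then obtain c where "F x y z = c * (g x (\<phi> y) * \<eta> z + g x (\<phi> z) * \<eta> y)"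
      if "x \<in> V" "y \<in> V" "z \<in> V" for x y z
      unfolding class_F5_def by blast
    then show "F \<in> vertical_F_space V \<phi> \<xi> \<eta>"
      using F by (simp add: vertical_F_space_def class_F5_def \<xi>_V \<eta>_\<xi> \<phi>_\<xi> g_simps V_closed algebra_simps)
  qed
  moreover have "class_F11 V \<phi> \<xi> \<eta> \<subseteq> vertical_F_space V \<phi> \<xi> \<eta>"
  proof
    fix F assume F: "F \<in> class_F11 V \<phi> \<xi> \<eta>"
    then have eq: "F x y z = \<eta> x * (\<eta> y * omega \<xi> F z + \<eta> z * omega \<xi> F y)"
      if "x \<in> V" "y \<in> V" "z \<in> V" for x y z
      using that by (simp add: class_F11_def)
    have "omega \<xi> F \<xi> = 0"
      using eq[OF \<xi>_V \<xi>_V \<xi>_V] by (simp add: omega_def \<eta>_\<xi>)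
    then show "F \<in> vertical_F_space V \<phi> \<xi> \<eta>"
      using F by (simp add: vertical_F_space_def class_F11_def eq \<xi>_V \<eta>_\<xi> algebra_simps)
  qed
  moreover have "class_F6 V \<phi> \<xi> \<eta> g \<subseteq> vertical_F_space V \<phi> \<xi> \<eta>"
    "class_F7 V \<phi> \<xi> \<eta> \<subseteq> vertical_F_space V \<phi> \<xi> \<eta>" "class_F8 V \<phi> \<xi> \<eta> \<subseteq> vertical_F_space V \<phi> \<xi> \<eta>"
    "class_F9 V \<phi> \<xi> \<eta> \<subseteq> vertical_F_space V \<phi> \<xi> \<eta>"
    by (auto simp: class_F6_def class_F7_def class_F8_def class_F9_def)
  ultimately show ?thesis
    unfolding class_U2_def
    by (intro subsetI) (auto elim!: set_plus_elim intro!: vertical_F_space_add)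
qed

text \<open>For \<open>e, s \<in> {1,-1}\<close> this is the projection onto the bilinear forms with \<open>T(y,x) = e T(x,y)\<close> and
  \<open>T(\<phi>x,\<phi>y) = s T(x,y)\<close>, on the space of forms that vanish if one argument is \<open>\<xi>\<close>.  The four pairs of signs are the symmetry types of the forms
  \<open>F(x,y,\<xi>)\<close> in \<open>F\<^sub>4 \<oplus> F\<^sub>5 \<oplus> F\<^sub>6\<close>, \<open>F\<^sub>7\<close>, \<open>F\<^sub>8\<close> and \<open>F\<^sub>9\<close>.\<close>

definition type_part :: "real \<Rightarrow> real \<Rightarrow> ('v \<Rightarrow> 'v \<Rightarrow> real) \<Rightarrow> 'v \<Rightarrow> 'v \<Rightarrow> real" where
  "type_part e s T = (\<lambda>x y. (1/4) * (T x y + e * T y x + s * (T (\<phi> x) (\<phi> y) + e * T (\<phi> y) (\<phi> x))))"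

lemma bilinear_form_type_part:
  assumes "bilinear_form T"
  shows "bilinear_form (type_part e s T)"
proof -
  have 1: "bilinear_form (\<lambda>x y. T y x)"
    by (rule bilinear_form_swap[OF assms])
  have 2: "bilinear_form (\<lambda>x y. T (\<phi> x) (\<phi> y))"
    by (rule bilinear_form_\<phi>[OF bilinear_form_swap[OF bilinear_form_\<phi>[OF 1]]])
  show ?thesis
    unfolding type_part_def
    by (rule bilinear_form_scale bilinear_form_add assms 1 2 bilinear_form_swap[OF 2])+
qed

lemma type_part_swap:
  assumes "e * e = 1"
  shows "type_part e s T y x = e * type_part e s T x y"
proof -
  have ee: "e * (e * r) = r" for r
    using assms mult.assoc[of e e r] by simp
  show ?thesis by (simp add: type_part_def ee algebra_simps)
qed

context
  fixes T :: "'v \<Rightarrow> 'v \<Rightarrow> real"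
  assumes T: "bilinear_form T" and T_\<xi>: "\<And>x. x \<in> V \<Longrightarrow> T x \<xi> = 0" "\<And>x. x \<in> V \<Longrightarrow> T \<xi> x = 0"
begin

lemma type_part_\<xi>: "x \<in> V \<Longrightarrow> type_part e s T x \<xi> = 0"
  by (simp add: type_part_def T_\<xi> \<phi>_\<xi> bilinear_form_simps[OF T] V_closed)

lemma type_part_\<phi>:
  assumes "s * s = 1" "x \<in> V" "y \<in> V"
  shows "type_part e s T (\<phi> x) (\<phi> y) = s * type_part e s T x y"
proof -
  have T_\<phi>_\<phi>: "T (\<phi> (\<phi> x)) (\<phi> (\<phi> y)) = T x y" if "x \<in> V" "y \<in> V" for x y
    using that by (simp add: \<phi>_\<phi> bilinear_form_simps[OF T] V_closed T_\<xi>)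
  have ss: "s * (s * r) = r" for r
    using assms(1) mult.assoc[of s s r] by simp
  show ?thesis
    using assms(2,3) by (simp add: type_part_def T_\<phi>_\<phi> ss algebra_simps)
qed

end

lemma type_part_sum:
  "T x y = type_part 1 (-1) T x y + type_part (-1) (-1) T x y + type_part 1 1 T x y + type_part (-1) 1 T x y"
  by (simp add: type_part_def field_simps)

text \<open>The forms \<open>g(\<phi>x,\<phi>y)\<close> and \<open>g(x,\<phi>y)\<close> span the part that carries the two traces \<open>t\<close> and \<open>t'\<close>.
  With \<open>\<tau> = t(g(x,\<phi>y))\<close> their traces form the matrix with rows \<open>(-2n, \<tau>)\<close> and \<open>(-\<tau>, -2n)\<close>, whose
  determinant \<open>4n\<^sup>2 + \<tau>\<^sup>2\<close> is positive whatever \<open>\<tau>\<close> is, so that any two values of the traces are attained.\<close>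

lemma trace_free_part:
  fixes t t' :: "('v \<Rightarrow> 'v \<Rightarrow> real) \<Rightarrow> real"
  defines "t \<equiv> metric_trace H g" and "t' \<equiv> \<lambda>T. metric_trace H g (\<lambda>x y. T x (\<phi> y))"
  obtains a b where "t T = t (\<lambda>x y. a * g (\<phi> x) (\<phi> y)) + t (\<lambda>x y. b * g x (\<phi> y))"
    "t' T = t' (\<lambda>x y. a * g (\<phi> x) (\<phi> y)) + t' (\<lambda>x y. b * g x (\<phi> y))"
    "t (\<lambda>x y. a * g (\<phi> x) (\<phi> y)) = - (2 * real n) * a"
    "t' (\<lambda>x y. b * g x (\<phi> y)) = - (2 * real n) * b"
proof -
  define \<tau> where "\<tau> = metric_trace H g (\<lambda>x y. g x (\<phi> y))"
  define d where "d = (2 * real n)\<^sup>2 + \<tau>\<^sup>2"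
  have d: "d > 0" using n by (simp add: d_def add_pos_nonneg)
  have 1: "t (\<lambda>x y. a * g (\<phi> x) (\<phi> y)) = - (2 * real n) * a" for a
  proof -
    have "t (\<lambda>x y. a * g (\<phi> x) (\<phi> y)) = metric_trace H g (\<lambda>x y. (- a) * g x y)"
      unfolding t_def by (rule metric_trace_cong[OF subspace_H]) (simp add: g_\<phi>_\<phi> ker_on_def)
    then show ?thesis by (simp only: metric_trace_scale metric_trace_metric) simp
  qed
  have 2: "t' (\<lambda>x y. a * g (\<phi> x) (\<phi> y)) = - a * \<tau>" for a
  proof -
    have "t' (\<lambda>x y. a * g (\<phi> x) (\<phi> y)) = metric_trace H g (\<lambda>x y. (- a) * g x (\<phi> y))"
      unfolding t'_def by (rule metric_trace_cong[OF subspace_H]) (simp add: g_\<phi>_\<phi> ker_on_def \<phi>_V)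
    then show ?thesis by (simp only: metric_trace_scale \<tau>_def)
  qed
  have 3: "t (\<lambda>x y. b * g x (\<phi> y)) = b * \<tau>" for b
    by (simp add: t_def metric_trace_scale \<tau>_def)
  have 4: "t' (\<lambda>x y. b * g x (\<phi> y)) = - (2 * real n) * b" for b
  proof -
    have "t' (\<lambda>x y. b * g x (\<phi> y)) = metric_trace H g (\<lambda>x y. (- b) * g x y)"
      unfolding t'_def
      by (rule metric_trace_cong[OF subspace_H]) (simp add: \<phi>_\<phi> ker_on_def g_simps V_closed)
    then show ?thesis by (simp only: metric_trace_scale metric_trace_metric) simp
  qed
  \<comment> \<open>Cramer's rule.\<close>
  define a where "a = - (2 * real n * t T + \<tau> * t' T) / d"
  define b where "b = (\<tau> * t T - 2 * real n * t' T) / d"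
  have "d * (- (2 * real n) * a + b * \<tau>) = d * t T" "d * (- a * \<tau> + - (2 * real n) * b) = d * t' T"
    using d by (simp_all add: a_def b_def field_simps) (simp_all add: d_def power2_eq_square algebra_simps)
  then have "t T = - (2 * real n) * a + b * \<tau>" "t' T = - a * \<tau> + - (2 * real n) * b"
    using d by simp_all
  then show thesis
    by (intro that[of a b]) (simp_all only: 1 2 3 4)
qed

text \<open>Let \<open>S(x,y) = F(x,y,\<xi>)\<close>.  Splitting off \<open>\<eta>(x) S(\<xi>,y)\<close>, which gives the component in \<open>F\<^sub>1\<^sub>1\<close>, leaves a
  form \<open>T\<close> that vanishes when either argument is \<open>\<xi>\<close>.  Such a form is invariant under applying \<open>\<phi>\<^sup>2\<close> to
  both arguments, so it is the sum of its four symmetry types.  Three of them are the components in \<open>F\<^sub>7\<close>,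
  \<open>F\<^sub>8\<close>, \<open>F\<^sub>9\<close>; the fourth one is split further into its traces, the components in \<open>F\<^sub>4\<close> and \<open>F\<^sub>5\<close>, and
  a trace-free rest in \<open>F\<^sub>6\<close>.\<close>

lemma vertical_F_space_subset: "vertical_F_space V \<phi> \<xi> \<eta> \<subseteq> class_U2 V n \<phi> \<xi> \<eta> g"
proof
  fix F assume F: "F \<in> vertical_F_space V \<phi> \<xi> \<eta>"
  note vF = vertical_F_space_eq_extension[OF F]
  \<comment> \<open>The scalar \<open>-1\<close> is kept explicit so that the closure properties of bilinear forms and traces
    under sums and multiples apply to differences.\<close>
  define T11 where "T11 x y = \<eta> x * F \<xi> y \<xi>" for x y
  define T where "T x y = F x y \<xi> + (-1) * T11 x y" for x y
  have T11: "bilinear_form T11"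
    using vF(2) \<xi>_V unfolding bilinear_form_def linear_map_on_def T11_def
    by (auto simp: linear_map_on_def \<eta>_simps V_closed algebra_simps)
  have T11_\<xi>: "T11 x \<xi> = 0" if "x \<in> V" for x
    by (simp add: T11_def vF(3) \<xi>_V)
  have T: "bilinear_form T"
    unfolding T_def[abs_def] by (intro bilinear_form_add bilinear_form_scale vF(2) T11)
  have T_\<xi>: "T x \<xi> = 0" "T \<xi> x = 0" if "x \<in> V" for x
    using that by (simp_all add: T_def T11_\<xi> vF(3)) (simp add: T11_def \<eta>_\<xi>)
  note part = bilinear_form_type_part[OF T] type_part_\<xi>[OF T T_\<xi>] type_part_swap type_part_\<phi>[OF T T_\<xi>]
  have part_symmetry: "vertical_extension (type_part e s T) x y \<xi> = e * vertical_extension (type_part e s T) y x \<xi>"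
    "vertical_extension (type_part e s T) x y \<xi> = s * vertical_extension (type_part e s T) (\<phi> x) (\<phi> y) \<xi>"
    if "e * e = 1" "s * s = 1" "x \<in> V" "y \<in> V" for e s x y
  proof -
    have "s * (s * r) = r" for r
      using that(2) mult.assoc[of s s r] by simp
    then show "vertical_extension (type_part e s T) x y \<xi> = s * vertical_extension (type_part e s T) (\<phi> x) (\<phi> y) \<xi>"
      using that part(4)[of s x y e] by (simp add: vertical_extension_\<xi> V_closed part(2))
    show "vertical_extension (type_part e s T) x y \<xi> = e * vertical_extension (type_part e s T) y x \<xi>"
      using that type_part_swap[of e s T x y] by (simp add: vertical_extension_\<xi> part(2))
  qed
  let ?P = "type_part 1 (-1) T"
  obtain a b where ab:
    "metric_trace H g ?P = metric_trace H g (\<lambda>x y. a * g (\<phi> x) (\<phi> y)) + metric_trace H g (\<lambda>x y. b * g x (\<phi> y))"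
    "metric_trace H g (\<lambda>x y. ?P x (\<phi> y)) = metric_trace H g (\<lambda>x y. a * g (\<phi> x) (\<phi> (\<phi> y)))
      + metric_trace H g (\<lambda>x y. b * g x (\<phi> (\<phi> y)))"
    "metric_trace H g (\<lambda>x y. a * g (\<phi> x) (\<phi> y)) = - (2 * real n) * a"
    "metric_trace H g (\<lambda>x y. b * g x (\<phi> (\<phi> y))) = - (2 * real n) * b"
    using trace_free_part[of ?P] .
  define T4 where "T4 x y = a * g (\<phi> x) (\<phi> y)" for x y
  define T5 where "T5 x y = b * g x (\<phi> y)" for x y
  define T6 where "T6 x y = ?P x y + (-1) * T4 x y + (-1) * T5 x y" for x y
  have T4: "bilinear_form T4"
    unfolding T4_def
    by (intro bilinear_form_scale bilinear_form_\<phi>[OF bilinear_form_swap[OF bilinear_form_\<phi>[OF bilinear_form_swap[OF bilinear_form_metric]]]])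
  have T5: "bilinear_form T5"
    unfolding T5_def by (intro bilinear_form_scale bilinear_form_\<phi> bilinear_form_metric)
  have T4_\<xi>: "T4 x \<xi> = 0" and T5_\<xi>: "T5 x \<xi> = 0" if "x \<in> V" for x
    using that by (simp_all add: T4_def T5_def \<phi>_\<xi> g_simps V_closed)
  have T6: "bilinear_form T6"
    unfolding T6_def[abs_def] by (intro bilinear_form_add bilinear_form_scale T4 T5 part(1))
  have T6_\<xi>: "T6 x \<xi> = 0" if "x \<in> V" for x
    using that by (simp add: T6_def T4_\<xi> T5_\<xi> part(2))
  have "vertical_extension T4 \<in> class_F4 V n \<phi> \<xi> \<eta> g"
    using vertical_F_space_imp[OF vertical_extension[OF T4 T4_\<xi>]] n
    by (simp add: class_F4_def theta_vertical_extension \<xi>_V \<eta>_\<xi> T4_def[abs_def] ab(3))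
      (simp add: vertical_extension_def algebra_simps)
  moreover have "vertical_extension T5 \<in> class_F5 V n \<phi> \<xi> \<eta> g"
    using vertical_F_space_imp[OF vertical_extension[OF T5 T5_\<xi>]] n
    by (simp add: class_F5_def theta_star_vertical_extension \<xi>_V \<eta>_\<xi> T5_def[abs_def] ab(4))
      (simp add: vertical_extension_def algebra_simps)
  moreover have "vertical_extension T6 \<in> class_F6 V \<phi> \<xi> \<eta> g"
  proof -
    have sym: "T6 x y = T6 y x" if "x \<in> V" "y \<in> V" for x y
    proof -
      have "?P x y = ?P y x"
        using type_part_swap[of 1 "-1" T x y] by simp
      moreover have "T4 x y = T4 y x"
        using g_sym that \<phi>_V by (simp add: T4_def)
      moreover have "T5 x y = T5 y x"
        unfolding T5_def using g_\<phi>_self_adjoint[OF that] g_sym[of "\<phi> x" y] that \<phi>_V by metis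
      ultimately show ?thesis by (simp only: T6_def)
    qed
    have anti: "T6 (\<phi> x) (\<phi> y) = - T6 x y" if "x \<in> V" "y \<in> V" for x y
    proof -
      have "?P (\<phi> x) (\<phi> y) = - ?P x y"
        using part(4)[of "-1" x y 1] that by simp
      moreover have "T4 (\<phi> x) (\<phi> y) = - T4 x y" "T5 (\<phi> x) (\<phi> y) = - T5 x y"
        using that by (simp_all add: g_\<phi>_\<phi> T4_def T5_def \<phi>_V \<eta>_\<phi> algebra_simps)
      ultimately show ?thesis by (simp add: T6_def)
    qed
    have tr: "metric_trace H g T6 = 0" "metric_trace H g (\<lambda>x y. T6 x (\<phi> y)) = 0"
      unfolding T6_def metric_trace_add metric_trace_scale[of H g "-1"] T4_def T5_def ab(1,2) by simp_all
    have "vertical_extension T6 x y \<xi> = T6 x y" if "x \<in> V" "y \<in> V" for x y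
      using that by (simp add: vertical_extension_\<xi> T6_\<xi>)
    then show ?thesis
      using vertical_extension[OF T6 T6_\<xi>] sym
      by (simp add: class_F6_def anti theta_vertical_extension theta_star_vertical_extension
        \<phi>_V tr)
  qed
  moreover have "vertical_extension (type_part (-1) (-1) T) \<in> class_F7 V \<phi> \<xi> \<eta>"
    using vertical_extension[OF part(1,2)] part_symmetry[of "-1" "-1", simplified] unfolding class_F7_def by blast
  moreover have "vertical_extension (type_part 1 1 T) \<in> class_F8 V \<phi> \<xi> \<eta>"
    using vertical_extension[OF part(1,2)] part_symmetry[of "1" "1", simplified] unfolding class_F8_def by blast
  moreover have "vertical_extension (type_part (-1) 1 T) \<in> class_F9 V \<phi> \<xi> \<eta>"
    using vertical_extension[OF part(1,2)] part_symmetry[of "-1" "1", simplified] unfolding class_F9_def by blast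
  moreover have "vertical_extension T11 \<in> class_F11 V \<phi> \<xi> \<eta>"
    using vertical_F_space_imp[OF vertical_extension[OF T11 T11_\<xi>]]
    by (simp add: class_F11_def)
      (simp add: vertical_extension_def omega_def T11_def \<xi>_V \<eta>_\<xi> vF(3) algebra_simps)
  ultimately have "vertical_extension T4 + vertical_extension T5 + vertical_extension T6
      + vertical_extension (type_part (-1) (-1) T) + vertical_extension (type_part 1 1 T)
      + vertical_extension (type_part (-1) 1 T) + vertical_extension T11 \<in> class_U2 V n \<phi> \<xi> \<eta> g"
    unfolding class_U2_def by (intro set_plus_intro)
  also have "vertical_extension T4 + vertical_extension T5 + vertical_extension T6
      + vertical_extension (type_part (-1) (-1) T) + vertical_extension (type_part 1 1 T)
      + vertical_extension (type_part (-1) 1 T) + vertical_extension T11 = vertical_extension (\<lambda>x y. F x y \<xi>)"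
    unfolding vertical_extension_add[symmetric]
  proof (rule vertical_extension_cong)
    fix x y
    show "T4 x y + T5 x y + T6 x y + type_part (-1) (-1) T x y + type_part 1 1 T x y
        + type_part (-1) 1 T x y + T11 x y = F x y \<xi>"
      using type_part_sum[of T x y] by (simp add: T6_def T_def)
  qed
  finally show "F \<in> class_U2 V n \<phi> \<xi> \<eta> g"
    using vF(1) by simp
qed

lemma class_U2_eq: "class_U2 V n \<phi> \<xi> \<eta> g = vertical_F_space V \<phi> \<xi> \<eta>"
  using class_U2_subset vertical_F_space_subset by blast

end

section \<open>Derivatives of the structure tensors\<close>

locale almost_contact_B_manifold =
  fixes M :: "('a, 'e::euclidean_space) manifold" and n :: nat
    and \<phi> :: "'a \<Rightarrow> 'a tvector \<Rightarrow> 'a tvector" and \<xi> :: "'a vfield"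
    and \<eta> :: "'a \<Rightarrow> 'a tvector \<Rightarrow> real" and g :: "'a \<Rightarrow> 'a tvector \<Rightarrow> 'a tvector \<Rightarrow> real"
    and nabla :: "'a connection"
  assumes almost_contact: "almost_contact_B_metric_manifold M n \<phi> \<xi> \<eta> g"
    and Levi_Civita: "Levi_Civita_connection M g nabla"
begin

sublocale smooth_mfd M
  using almost_contact by unfold_locales (simp add: almost_contact_B_metric_manifold_def)

lemma tangent_almost_contact_B_space:
  assumes p: "p \<in> points M"
  shows "almost_contact_B_space (tangent_space M p) n (\<phi> p) (\<xi> p) (\<eta> p) (g p)"
proof
  note st = almost_contact[unfolded almost_contact_B_metric_manifold_def]
  show "subspace (tangent_space M p)"
    by (rule subspace_tangent_space[OF p])
  show "n \<ge> 1" using st by blast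
  show "linear_map_on (tangent_space M p) (\<phi> p)"
    and "x \<in> tangent_space M p \<Longrightarrow> \<phi> p x \<in> tangent_space M p" for x
    using st p unfolding endomorphism_field_def by blast+
  show "linear_map_on (tangent_space M p) (\<eta> p)"
    using st p unfolding one_form_def by blast
  show "\<xi> p \<in> tangent_space M p"
    using st p vector_field_tangent by blast
  show "x \<in> tangent_space M p \<Longrightarrow> linear_map_on (tangent_space M p) (g p x)"
    and "x \<in> tangent_space M p \<Longrightarrow> y \<in> tangent_space M p \<Longrightarrow> g p x y = g p y x"
    and "has_signature (tangent_space M p) (g p) (n + 1) n" for x y
    using st p unfolding pseudo_Riemannian_metric_def by blast+
  show "\<phi> p (\<xi> p) = 0" "\<eta> p (\<xi> p) = 1"
    and "x \<in> tangent_space M p \<Longrightarrow> \<phi> p (\<phi> p x) = - x + \<eta> p x *\<^sub>R \<xi> p"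
    and "x \<in> tangent_space M p \<Longrightarrow> \<eta> p (\<phi> p x) = 0"
    and "x \<in> tangent_space M p \<Longrightarrow> y \<in> tangent_space M p \<Longrightarrow>
      g p (\<phi> p x) (\<phi> p y) = - g p x y + \<eta> p x * \<eta> p y" for x y
    using st p by blast+
qed

lemma \<xi>_field: "\<xi> \<in> vector_fields M"
  using almost_contact by (simp add: almost_contact_B_metric_manifold_def)

lemma \<phi>_field: "X \<in> vector_fields M \<Longrightarrow> (\<lambda>p. \<phi> p (X p)) \<in> vector_fields M"
  using almost_contact by (simp add: almost_contact_B_metric_manifold_def endomorphism_field_def)

lemma \<eta>_smooth: "X \<in> vector_fields M \<Longrightarrow> (\<lambda>p. \<eta> p (X p)) \<in> smooth_functions M"
  using almost_contact by (simp add: almost_contact_B_metric_manifold_def one_form_def)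

lemma g_smooth:
  "X \<in> vector_fields M \<Longrightarrow> Y \<in> vector_fields M \<Longrightarrow> (\<lambda>p. g p (X p) (Y p)) \<in> smooth_functions M"
  using almost_contact by (simp add: almost_contact_B_metric_manifold_def pseudo_Riemannian_metric_def)

lemma vpart_field: "X \<in> vector_fields M \<Longrightarrow> vpart \<xi> \<eta> X \<in> vector_fields M"
  unfolding vpart_def by (intro vector_field_scale \<eta>_smooth \<xi>_field)

lemma hpart_field: "X \<in> vector_fields M \<Longrightarrow> hpart \<xi> \<eta> X \<in> vector_fields M"
  unfolding hpart_def by (intro vector_field_diff vector_field_scale \<eta>_smooth \<xi>_field)

text \<open>Outside the manifold \<open>\<phi>\<close> is constrained only through the normalisation of vector fields.\<close>

lemma \<phi>_zero_outside: "p \<notin> points M \<Longrightarrow> \<phi> p 0 = 0"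
  using vector_field_outside[OF \<xi>_field] vector_field_outside[OF \<phi>_field[OF \<xi>_field]] by simp

lemma nabla_linear: "linear_connection M nabla"
  using Levi_Civita by (simp add: Levi_Civita_connection_def)

lemma nabla_field: "X \<in> vector_fields M \<Longrightarrow> Y \<in> vector_fields M \<Longrightarrow> nabla X Y \<in> vector_fields M"
  using nabla_linear by (simp add: linear_connection_def)

lemma nabla_add_left:
  "X \<in> vector_fields M \<Longrightarrow> X' \<in> vector_fields M \<Longrightarrow> Y \<in> vector_fields M \<Longrightarrow>
    nabla (\<lambda>p. X p + X' p) Y = (\<lambda>p. nabla X Y p + nabla X' Y p)"
  using nabla_linear
  unfolding linear_connection_def plus_fun_def[of X X', symmetric] plus_fun_def[of "nabla X Y", symmetric]
  by blast

lemma nabla_add: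
  "X \<in> vector_fields M \<Longrightarrow> Y \<in> vector_fields M \<Longrightarrow> Y' \<in> vector_fields M \<Longrightarrow>
    nabla X (\<lambda>p. Y p + Y' p) = (\<lambda>p. nabla X Y p + nabla X Y' p)"
  using nabla_linear
  unfolding linear_connection_def plus_fun_def[of Y Y', symmetric] plus_fun_def[of "nabla X Y", symmetric]
  by blast

lemma nabla_scale_left:
  "f \<in> smooth_functions M \<Longrightarrow> X \<in> vector_fields M \<Longrightarrow> Y \<in> vector_fields M \<Longrightarrow>
    nabla (\<lambda>p. f p *\<^sub>R X p) Y = (\<lambda>p. f p *\<^sub>R nabla X Y p)"
  using nabla_linear by (simp add: linear_connection_def)

lemma nabla_scale:
  "f \<in> smooth_functions M \<Longrightarrow> X \<in> vector_fields M \<Longrightarrow> Y \<in> vector_fields M \<Longrightarrow>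
    nabla X (\<lambda>p. f p *\<^sub>R Y p) = (\<lambda>p. X p f *\<^sub>R Y p + f p *\<^sub>R nabla X Y p)"
  using nabla_linear by (simp add: linear_connection_def)

lemma nabla_minus:
  assumes "X \<in> vector_fields M" "Y \<in> vector_fields M" "p \<in> points M"
  shows "nabla X (\<lambda>q. - Y q) p = - nabla X Y p"
  using nabla_scale[OF smooth_const[of "-1"] assms(1,2)]
    tangent_vector_const[OF assms(3) vector_field_tangent[OF assms(1,3)]] by (simp add: fun_eq_iff)

lemma nabla_diff:
  assumes "X \<in> vector_fields M" "Y \<in> vector_fields M" "Z \<in> vector_fields M" "p \<in> points M"
  shows "nabla X (\<lambda>q. Y q - Z q) p = nabla X Y p - nabla X Z p"
proof -
  have "(\<lambda>q. - Z q) \<in> vector_fields M"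
    using vector_field_diff[OF vector_field_zero assms(3)] by simp
  from nabla_add[OF assms(1,2) this] show ?thesis
    using nabla_minus[OF assms(1,3,4)] by simp
qed

context
  fixes p assumes p: "p \<in> points M"
begin

interpretation A: almost_contact_B_space "tangent_space M p" n "\<phi> p" "\<xi> p" "\<eta> p" "g p"
  by (rule tangent_almost_contact_B_space[OF p])

lemmas tangent = vector_field_tangent[OF _ p] nabla_field \<xi>_field \<phi>_field A.V_closed

lemma nabla_metric:
  assumes "X \<in> vector_fields M" "Y \<in> vector_fields M" "Z \<in> vector_fields M"
  shows "X p (\<lambda>q. g q (Y q) (Z q)) = g p (nabla X Y p) (Z p) + g p (Y p) (nabla X Z p)"
proof -
  have "deriv_metric nabla g X Y Z p = 0"
    using Levi_Civita assms p unfolding Levi_Civita_connection_def by blast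
  then show ?thesis by (simp add: deriv_metric_def)
qed

lemma derivative_cong:
  assumes "X \<in> vector_fields M" "f \<in> smooth_functions M" "\<And>q. q \<in> points M \<Longrightarrow> f q = h q"
  shows "X p f = X p h"
  using tangent_vector_cong[OF p vector_field_tangent[OF assms(1) p] assms(2,3)] .

lemma derivative_const: "X \<in> vector_fields M \<Longrightarrow> X p (\<lambda>_. c) = 0"
  using tangent_vector_const[OF p vector_field_tangent[OF _ p]] .

text \<open>Differentiate \<open>g(\<xi>,\<xi>) = 1\<close>.\<close>

lemma \<eta>_nabla_\<xi>:
  assumes X: "X \<in> vector_fields M"
  shows "\<eta> p (nabla X \<xi> p) = 0"
proof -
  have "g q (\<xi> q) (\<xi> q) = 1" if "q \<in> points M" for q
  proof -
    interpret Q: almost_contact_B_space "tangent_space M q" n "\<phi> q" "\<xi> q" "\<eta> q" "g q"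
      by (rule tangent_almost_contact_B_space[OF that])
    show ?thesis by (simp add: Q.g_\<xi> Q.\<xi>_V Q.\<eta>_\<xi>)
  qed
  then have "X p (\<lambda>q. g q (\<xi> q) (\<xi> q)) = X p (\<lambda>_. 1)"
    by (rule derivative_cong[OF X g_smooth[OF \<xi>_field \<xi>_field]])
  moreover have "nabla X \<xi> p \<in> tangent_space M p"
    by (rule vector_field_tangent[OF nabla_field[OF X \<xi>_field] p])
  ultimately show ?thesis
    using nabla_metric[OF X \<xi>_field \<xi>_field] A.g_sym[OF A.\<xi>_V, of "nabla X \<xi> p"]
      derivative_const[OF X, of 1] A.g_\<xi> by simp
qed

text \<open>Differentiate \<open>\<eta>(Y) = g(Y,\<xi>)\<close>, using \<open>\<nabla>g = 0\<close>.\<close>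

lemma nabla_\<eta>:
  assumes X: "X \<in> vector_fields M" and Y: "Y \<in> vector_fields M"
  shows "deriv_form nabla \<eta> X Y p = g p (nabla X \<xi> p) (Y p)"
proof -
  have "\<eta> q (Y q) = g q (Y q) (\<xi> q)" if q: "q \<in> points M" for q
  proof -
    interpret Q: almost_contact_B_space "tangent_space M q" n "\<phi> q" "\<xi> q" "\<eta> q" "g q"
      by (rule tangent_almost_contact_B_space[OF q])
    show ?thesis by (simp add: Q.g_\<xi> vector_field_tangent[OF Y q])
  qed
  then have "X p (\<lambda>q. \<eta> q (Y q)) = X p (\<lambda>q. g q (Y q) (\<xi> q))"
    by (rule derivative_cong[OF X \<eta>_smooth[OF Y]])
  then show ?thesis
    using X Y A.g_sym[of "Y p" "nabla X \<xi> p"]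
    by (simp add: deriv_form_def nabla_metric \<xi>_field A.g_\<xi> tangent)
qed

text \<open>Differentiate \<open>\<eta>(\<phi>Y) = 0\<close>.\<close>

lemma \<eta>_nabla_\<phi>:
  assumes X: "X \<in> vector_fields M" and Y: "Y \<in> vector_fields M"
  shows "\<eta> p (deriv_endo nabla \<phi> X Y p) = - g p (nabla X \<xi> p) (\<phi> p (Y p))"
proof -
  have "\<eta> q (\<phi> q (Y q)) = 0" if q: "q \<in> points M" for q
  proof -
    interpret Q: almost_contact_B_space "tangent_space M q" n "\<phi> q" "\<xi> q" "\<eta> q" "g q"
      by (rule tangent_almost_contact_B_space[OF q])
    show ?thesis by (simp add: Q.\<eta>_\<phi> vector_field_tangent[OF Y q])
  qed
  then have "X p (\<lambda>q. \<eta> q (\<phi> q (Y q))) = X p (\<lambda>_. 0)"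
    by (rule derivative_cong[OF X \<eta>_smooth[OF \<phi>_field[OF Y]]])
  then have "- \<eta> p (nabla X (\<lambda>q. \<phi> q (Y q)) p) = g p (nabla X \<xi> p) (\<phi> p (Y p))"
    using nabla_\<eta>[OF X \<phi>_field[OF Y]] X by (simp add: derivative_const deriv_form_def)
  then show ?thesis
    using X Y by (simp add: deriv_endo_def A.\<eta>_simps A.\<eta>_\<phi> tangent)
qed

text \<open>Differentiate \<open>g(\<phi>Y,Z) = g(Y,\<phi>Z)\<close>: covariant derivatives of self-adjoint endomorphisms are
  self-adjoint.\<close>

lemma nabla_\<phi>_self_adjoint:
  assumes X: "X \<in> vector_fields M" and Y: "Y \<in> vector_fields M" and Z: "Z \<in> vector_fields M"
  shows "g p (deriv_endo nabla \<phi> X Y p) (Z p) = g p (deriv_endo nabla \<phi> X Z p) (Y p)"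
proof -
  have "g q (\<phi> q (Y q)) (Z q) = g q (Y q) (\<phi> q (Z q))" if q: "q \<in> points M" for q
  proof -
    interpret Q: almost_contact_B_space "tangent_space M q" n "\<phi> q" "\<xi> q" "\<eta> q" "g q"
      by (rule tangent_almost_contact_B_space[OF q])
    show ?thesis by (intro Q.g_\<phi>_self_adjoint vector_field_tangent Y Z q)
  qed
  then have "X p (\<lambda>q. g q (\<phi> q (Y q)) (Z q)) = X p (\<lambda>q. g q (Y q) (\<phi> q (Z q)))"
    by (rule derivative_cong[OF X g_smooth[OF \<phi>_field[OF Y] Z]])
  then have "g p (nabla X (\<lambda>q. \<phi> q (Y q)) p) (Z p) + g p (\<phi> p (Y p)) (nabla X Z p)
      = g p (nabla X Y p) (\<phi> p (Z p)) + g p (Y p) (nabla X (\<lambda>q. \<phi> q (Z q)) p)"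
    by (simp add: nabla_metric[OF X \<phi>_field[OF Y] Z] nabla_metric[OF X Y \<phi>_field[OF Z]])
  moreover have "g p (\<phi> p (Y p)) (nabla X Z p) = g p (\<phi> p (nabla X Z p)) (Y p)"
    using A.g_\<phi>_self_adjoint[of "Y p" "nabla X Z p"] A.g_sym[of "Y p" "\<phi> p (nabla X Z p)"] X Y Z
    by (simp add: tangent)
  moreover have "g p (nabla X Y p) (\<phi> p (Z p)) = g p (\<phi> p (nabla X Y p)) (Z p)"
    using A.g_\<phi>_self_adjoint[of "nabla X Y p" "Z p"] X Y Z by (simp add: tangent)
  moreover have "g p (Y p) (nabla X (\<lambda>q. \<phi> q (Z q)) p) = g p (nabla X (\<lambda>q. \<phi> q (Z q)) p) (Y p)"
    using X Y Z by (intro A.g_sym) (simp_all add: tangent)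
  ultimately show ?thesis
    using X Y Z by (simp add: deriv_endo_def A.g_simps tangent)
qed

text \<open>Differentiate \<open>\<phi>\<^sup>2 = -Id + \<eta> \<otimes> \<xi>\<close>.\<close>

lemma nabla_\<phi>_\<phi>:
  assumes X: "X \<in> vector_fields M" and Y: "Y \<in> vector_fields M"
  shows "deriv_endo nabla \<phi> X (\<lambda>q. \<phi> q (Y q)) p =
    - \<phi> p (deriv_endo nabla \<phi> X Y p) + deriv_form nabla \<eta> X Y p *\<^sub>R \<xi> p + \<eta> p (Y p) *\<^sub>R nabla X \<xi> p"
proof -
  have eq: "(\<lambda>q. \<phi> q (\<phi> q (Y q))) = (\<lambda>q. \<eta> q (Y q) *\<^sub>R \<xi> q - Y q)"
  proof (rule vector_field_eqI)
    fix q assume q: "q \<in> points M"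
    interpret Q: almost_contact_B_space "tangent_space M q" n "\<phi> q" "\<xi> q" "\<eta> q" "g q"
      by (rule tangent_almost_contact_B_space[OF q])
    show "\<phi> q (\<phi> q (Y q)) = \<eta> q (Y q) *\<^sub>R \<xi> q - Y q"
      by (simp add: Q.\<phi>_\<phi> vector_field_tangent[OF Y q])
  qed (intro \<phi>_field vector_field_diff vector_field_scale \<eta>_smooth \<xi>_field Y)+
  have "nabla X (\<lambda>q. \<phi> q (\<phi> q (Y q))) p
      = X p (\<lambda>q. \<eta> q (Y q)) *\<^sub>R \<xi> p + \<eta> p (Y p) *\<^sub>R nabla X \<xi> p - nabla X Y p"
    unfolding eq
    using nabla_diff[OF X vector_field_scale[OF \<eta>_smooth[OF Y] \<xi>_field] Y p]
      nabla_scale[OF \<eta>_smooth[OF Y] X \<xi>_field] by simp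
  then show ?thesis
    using X Y
    by (simp add: deriv_endo_def deriv_form_def A.\<phi>_simps A.\<phi>_\<phi> tangent scaleR_left_diff_distrib)
qed

lemma deriv_endo_tangent:
  "X \<in> vector_fields M \<Longrightarrow> Y \<in> vector_fields M \<Longrightarrow> deriv_endo nabla \<phi> X Y p \<in> tangent_space M p"
  unfolding deriv_endo_def by (intro A.V_closed vector_field_tangent[OF _ p] nabla_field \<phi>_field)

lemma deriv_endo_add_left:
  assumes "X \<in> vector_fields M" "X' \<in> vector_fields M" "Y \<in> vector_fields M"
  shows "deriv_endo nabla \<phi> (\<lambda>q. X q + X' q) Y p = deriv_endo nabla \<phi> X Y p + deriv_endo nabla \<phi> X' Y p"
  using assms by (simp add: deriv_endo_def nabla_add_left A.\<phi>_simps tangent)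

lemma deriv_endo_scale_left:
  assumes "f \<in> smooth_functions M" "X \<in> vector_fields M" "Y \<in> vector_fields M"
  shows "deriv_endo nabla \<phi> (\<lambda>q. f q *\<^sub>R X q) Y p = f p *\<^sub>R deriv_endo nabla \<phi> X Y p"
  using assms by (simp add: deriv_endo_def nabla_scale_left A.\<phi>_simps tangent scaleR_diff_right)

lemma deriv_endo_add:
  assumes X: "X \<in> vector_fields M" and Y: "Y \<in> vector_fields M" "Y' \<in> vector_fields M"
  shows "deriv_endo nabla \<phi> X (\<lambda>q. Y q + Y' q) p = deriv_endo nabla \<phi> X Y p + deriv_endo nabla \<phi> X Y' p"
proof -
  have "(\<lambda>q. \<phi> q (Y q + Y' q)) = (\<lambda>q. \<phi> q (Y q) + \<phi> q (Y' q))"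
  proof (rule vector_field_eqI)
    fix q assume q: "q \<in> points M"
    interpret Q: almost_contact_B_space "tangent_space M q" n "\<phi> q" "\<xi> q" "\<eta> q" "g q"
      by (rule tangent_almost_contact_B_space[OF q])
    show "\<phi> q (Y q + Y' q) = \<phi> q (Y q) + \<phi> q (Y' q)"
      using Y by (simp add: Q.\<phi>_simps vector_field_tangent[OF _ q])
  qed (intro \<phi>_field vector_field_add Y)+
  then show ?thesis
    using X Y by (simp add: deriv_endo_def nabla_add A.\<phi>_simps tangent)
qed

lemma deriv_endo_scale:
  assumes f: "f \<in> smooth_functions M" and X: "X \<in> vector_fields M" and Y: "Y \<in> vector_fields M"
  shows "deriv_endo nabla \<phi> X (\<lambda>q. f q *\<^sub>R Y q) p = f p *\<^sub>R deriv_endo nabla \<phi> X Y p"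
proof -
  have "(\<lambda>q. \<phi> q (f q *\<^sub>R Y q)) = (\<lambda>q. f q *\<^sub>R \<phi> q (Y q))"
  proof (rule vector_field_eqI)
    fix q assume q: "q \<in> points M"
    interpret Q: almost_contact_B_space "tangent_space M q" n "\<phi> q" "\<xi> q" "\<eta> q" "g q"
      by (rule tangent_almost_contact_B_space[OF q])
    show "\<phi> q (f q *\<^sub>R Y q) = f q *\<^sub>R \<phi> q (Y q)"
      using Y by (simp add: Q.\<phi>_simps vector_field_tangent[OF _ q])
  qed (intro \<phi>_field vector_field_scale f Y)+
  then show ?thesis
    using f X Y by (simp add: deriv_endo_def nabla_scale A.\<phi>_simps tangent scaleR_diff_right)
qed

section \<open>The fundamental tensor\<close>

text \<open>Since \<open>\<nabla>\<phi>\<close> is a tensor, arbitrary fields with the given values at \<open>p\<close> may be used in place of the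
  extensions that enter the definition.  Every later computation with \<open>F\<close> rests on this freedom, for
  instance to use \<open>\<phi>Y\<close> as an extension of \<open>\<phi>y\<close>.\<close>

lemma fundamental_tensor_fields:
  assumes X: "X \<in> vector_fields M" and Y: "Y \<in> vector_fields M" and z: "z \<in> tangent_space M p"
  shows "fundamental_tensor M \<phi> g nabla p (X p) (Y p) z = g p (deriv_endo nabla \<phi> X Y p) z"
proof -
  let ?X = "extension_field M p (X p)" and ?Y = "extension_field M p (Y p)"
  note ext = extension_field[OF p vector_field_tangent[OF X p]]
    extension_field[OF p vector_field_tangent[OF Y p]]
  have "deriv_endo nabla \<phi> ?X ?Y p = deriv_endo nabla \<phi> X ?Y p"
    by (rule tensoriality[where A = "\<lambda>X. deriv_endo nabla \<phi> X ?Y p", OF p])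
      (simp_all add: ext X deriv_endo_add_left deriv_endo_scale_left)
  also have "\<dots> = deriv_endo nabla \<phi> X Y p"
    by (rule tensoriality[where A = "\<lambda>Y. deriv_endo nabla \<phi> X Y p", OF p])
      (simp_all add: ext X Y deriv_endo_add deriv_endo_scale)
  finally show ?thesis
    using X Y z by (simp add: fundamental_tensor_def vector_field_tangent p)
qed

lemma fundamental_tensor_\<xi>:
  assumes X: "X \<in> vector_fields M" and Y: "Y \<in> vector_fields M"
  shows "fundamental_tensor M \<phi> g nabla p (X p) (Y p) (\<xi> p) = - g p (nabla X \<xi> p) (\<phi> p (Y p))"
  using X Y by (simp add: fundamental_tensor_fields A.\<xi>_V A.g_\<xi> deriv_endo_tangent \<eta>_nabla_\<phi>)

text \<open>The symmetry of \<open>F\<close> is the self-adjointness of \<open>\<nabla>\<phi>\<close>.  For the second identity substitute the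
  derivative of \<open>\<phi>\<^sup>2\<close> in \<open>F(x,\<phi>y,\<phi>z) = g((\<nabla>\<^sub>x\<phi>)\<phi>y, \<phi>z)\<close> and use \<open>F(x,\<xi>,z) = -g(\<nabla>\<^sub>x\<xi>, \<phi>z)\<close>.\<close>

lemma fundamental_tensor_F_space:
  "fundamental_tensor M \<phi> g nabla p \<in> F_space (tangent_space M p) (\<phi> p) (\<xi> p) (\<eta> p)"
proof -
  let ?T = "tangent_space M p" and ?F = "fundamental_tensor M \<phi> g nabla p"
  have F: "?F x y z = g p (deriv_endo nabla \<phi> X Y p) z"
    if "X \<in> vector_fields M" "X p = x" "Y \<in> vector_fields M" "Y p = y" "z \<in> ?T" for x y z X Y
    using fundamental_tensor_fields that by blast
  have comb: "(\<lambda>q. a *\<^sub>R X q + b *\<^sub>R Y q) \<in> vector_fields M"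
    if "X \<in> vector_fields M" "Y \<in> vector_fields M" for a b and X Y :: "'a vfield"
    using that by (intro vector_field_add vector_field_scale smooth_const)
  have sm: "(\<lambda>q. a *\<^sub>R X q) \<in> vector_fields M" if "X \<in> vector_fields M" for a and X :: "'a vfield"
    using that by (intro vector_field_scale smooth_const)
  have lin: "linear_map_on ?T (\<lambda>w. ?F w x y)" "linear_map_on ?T (\<lambda>w. ?F x w y)"
    "linear_map_on ?T (\<lambda>w. ?F x y w)" if x: "x \<in> ?T" and y: "y \<in> ?T" for x y
  proof -
    obtain X Y where X: "X \<in> vector_fields M" "X p = x" and Y: "Y \<in> vector_fields M" "Y p = y"
      using extension_field[OF p x] extension_field[OF p y] by blast
    show "linear_map_on ?T (\<lambda>w. ?F x y w)"
      using A.g_linear[OF deriv_endo_tangent[OF X(1) Y(1)]]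
      by (simp add: linear_map_on_def F[OF X Y] A.V_closed)
    show "linear_map_on ?T (\<lambda>w. ?F w x y)" "linear_map_on ?T (\<lambda>w. ?F x w y)"
      unfolding linear_map_on_def
    proof (safe)
      fix u v a b assume uv: "u \<in> ?T" "v \<in> ?T"
      obtain U W where U: "U \<in> vector_fields M" "U p = u" and W: "W \<in> vector_fields M" "W p = v"
        using extension_field[OF p uv(1)] extension_field[OF p uv(2)] by blast
      let ?C = "\<lambda>q. a *\<^sub>R U q + b *\<^sub>R W q"
      have C: "?C \<in> vector_fields M" "?C p = a *\<^sub>R u + b *\<^sub>R v"
        using comb[OF U(1) W(1)] U W by simp_all
      have "deriv_endo nabla \<phi> ?C X p = a *\<^sub>R deriv_endo nabla \<phi> U X p + b *\<^sub>R deriv_endo nabla \<phi> W X p"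
        by (simp only: deriv_endo_add_left[OF sm[OF U(1)] sm[OF W(1)] X(1)]
          deriv_endo_scale_left[OF smooth_const U(1) X(1)] deriv_endo_scale_left[OF smooth_const W(1) X(1)])
      then show "?F (a *\<^sub>R u + b *\<^sub>R v) x y = a *\<^sub>R ?F u x y + b *\<^sub>R ?F v x y"
        using U(1) W(1) X(1) y
        by (simp only: F[OF C X y] F[OF U X y] F[OF W X y])
          (simp add: A.g_simps A.V_closed deriv_endo_tangent)
      have "deriv_endo nabla \<phi> X ?C p = a *\<^sub>R deriv_endo nabla \<phi> X U p + b *\<^sub>R deriv_endo nabla \<phi> X W p"
        by (simp only: deriv_endo_add[OF X(1) sm[OF U(1)] sm[OF W(1)]]
          deriv_endo_scale[OF smooth_const X(1) U(1)] deriv_endo_scale[OF smooth_const X(1) W(1)])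
      then show "?F x (a *\<^sub>R u + b *\<^sub>R v) y = a *\<^sub>R ?F x u y + b *\<^sub>R ?F x v y"
        using U(1) W(1) X(1) y
        by (simp only: F[OF X C y] F[OF X U y] F[OF X W y])
          (simp add: A.g_simps A.V_closed deriv_endo_tangent)
    qed
  qed
  have sym: "?F x y z = ?F x z y"
    and id: "?F x y z = ?F x (\<phi> p y) (\<phi> p z) + \<eta> p y * ?F x (\<xi> p) z + \<eta> p z * ?F x y (\<xi> p)"
    if xyz: "x \<in> ?T" "y \<in> ?T" "z \<in> ?T" for x y z
  proof -
    obtain X Y Z where X: "X \<in> vector_fields M" "X p = x" and Y: "Y \<in> vector_fields M" "Y p = y"
      and Z: "Z \<in> vector_fields M" "Z p = z"
      using extension_field[OF p xyz(1)] extension_field[OF p xyz(2)] extension_field[OF p xyz(3)] by blast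
    have sym': "?F x (Y p) (Z p) = ?F x (Z p) (Y p)"
      if "Y \<in> vector_fields M" "Z \<in> vector_fields M" for Y Z
      using nabla_\<phi>_self_adjoint[OF X(1) that] that
      by (simp add: F[OF X that(1) refl] F[OF X that(2) refl] vector_field_tangent p)
    show "?F x y z = ?F x z y"
      using sym'[OF Y(1) Z(1)] Y Z by simp
    let ?d = "deriv_endo nabla \<phi> X Y p"
    have d: "?d \<in> ?T" "nabla X \<xi> p \<in> ?T"
      using X Y by (simp_all add: deriv_endo_tangent tangent)
    have "?F x (\<xi> p) z = - g p (nabla X \<xi> p) (\<phi> p z)"
      using sym'[OF \<xi>_field Z(1)] fundamental_tensor_\<xi>[OF X(1) Z(1)] X Z by simp
    moreover have "?F x y (\<xi> p) = \<eta> p ?d"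
      using fundamental_tensor_\<xi>[OF X(1) Y(1)] \<eta>_nabla_\<phi>[OF X(1) Y(1)] X Y by simp
    moreover have "?F x (\<phi> p y) (\<phi> p z) = g p ?d z - \<eta> p ?d * \<eta> p z + \<eta> p y * g p (nabla X \<xi> p) (\<phi> p z)"
      using xyz d A.g_sym[of "\<xi> p" "\<phi> p z"] Y(2)
      by (simp add: F[OF X \<phi>_field[OF Y(1)]] nabla_\<phi>_\<phi>[OF X(1) Y(1)] A.g_simps A.V_closed A.g_\<phi>_\<phi>
        A.g_\<xi> A.\<eta>_\<phi>)
    ultimately show "?F x y z = ?F x (\<phi> p y) (\<phi> p z) + \<eta> p y * ?F x (\<xi> p) z + \<eta> p z * ?F x y (\<xi> p)"
      using F[OF X Y xyz(3)] by simp
  qed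
  have "?F x y z = 0" if "\<not> (x \<in> ?T \<and> y \<in> ?T \<and> z \<in> ?T)" for x y z
    using that by (simp only: fundamental_tensor_def if_False)
  with lin sym id show ?thesis
    unfolding F_space_def by blast
qed

end

section \<open>The Schouten-van Kampen connection\<close>

abbreviation D :: "'a connection" where
  "D \<equiv> Schouten_van_Kampen \<xi> \<eta> nabla"

lemma Schouten_van_Kampen_field:
  "X \<in> vector_fields M \<Longrightarrow> Y \<in> vector_fields M \<Longrightarrow> D X Y \<in> vector_fields M"
  unfolding Schouten_van_Kampen_def plus_fun_def[of "hpart _ _ _"]
  by (intro vector_field_add hpart_field vpart_field nabla_field)

text \<open>The Leibniz rule gives \<open>\<nabla>\<^sub>x(\<eta>(y)\<xi>) = x(\<eta>(y))\<xi> + \<eta>(y)\<nabla>\<^sub>x\<xi>\<close>, and \<open>\<nabla>\<^sub>x\<xi>\<close> is horizontal; the remaining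
  vertical terms add up to \<open>(\<nabla>\<^sub>x\<eta>)(y)\<xi> = g(\<nabla>\<^sub>x\<xi>,y)\<xi>\<close>.\<close>

lemma Schouten_van_Kampen_eq:
  assumes X: "X \<in> vector_fields M" and Y: "Y \<in> vector_fields M" and p: "p \<in> points M"
  shows "D X Y p = nabla X Y p - \<eta> p (Y p) *\<^sub>R nabla X \<xi> p + g p (nabla X \<xi> p) (Y p) *\<^sub>R \<xi> p"
proof -
  interpret A: almost_contact_B_space "tangent_space M p" n "\<phi> p" "\<xi> p" "\<eta> p" "g p"
    by (rule tangent_almost_contact_B_space[OF p])
  note tan = vector_field_tangent[OF _ p] nabla_field X Y \<xi>_field A.V_closed
  have v: "nabla X (vpart \<xi> \<eta> Y) p = X p (\<lambda>q. \<eta> q (Y q)) *\<^sub>R \<xi> p + \<eta> p (Y p) *\<^sub>R nabla X \<xi> p"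
    unfolding vpart_def using nabla_scale[OF \<eta>_smooth[OF Y] X \<xi>_field] by simp
  have h: "nabla X (hpart \<xi> \<eta> Y) p = nabla X Y p - nabla X (vpart \<xi> \<eta> Y) p"
    unfolding hpart_def using nabla_diff[OF X Y vpart_field[OF Y] p] by (simp add: vpart_def)
  have "D X Y p = nabla X Y p - \<eta> p (Y p) *\<^sub>R nabla X \<xi> p + deriv_form nabla \<eta> X Y p *\<^sub>R \<xi> p"
    by (simp add: Schouten_van_Kampen_def hpart_def[of _ _ "nabla _ _"] vpart_def[of _ _ "nabla _ _"] h v
      A.\<eta>_simps A.\<eta>_\<xi> \<eta>_nabla_\<xi>[OF p X] tan deriv_form_def algebra_simps)
  then show ?thesis by (simp add: nabla_\<eta>[OF p X Y])
qed

lemma Schouten_van_Kampen_linear: "linear_connection M D"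
proof -
  have "D (X + X') Y = D X Y + D X' Y"
    if X: "X \<in> vector_fields M" and X': "X' \<in> vector_fields M" and Y: "Y \<in> vector_fields M" for X X' Y
    unfolding plus_fun_def[of X] plus_fun_def[of "D X Y"]
  proof (rule vector_field_eqI)
    fix p assume p: "p \<in> points M"
    interpret A: almost_contact_B_space "tangent_space M p" n "\<phi> p" "\<xi> p" "\<eta> p" "g p"
      by (rule tangent_almost_contact_B_space[OF p])
    show "D (\<lambda>p. X p + X' p) Y p = D X Y p + D X' Y p"
      using vector_field_add[OF X X'] X X' Y p
      by (simp add: Schouten_van_Kampen_eq nabla_add_left \<xi>_field A.g_simps vector_field_tangent nabla_field
        algebra_simps)
  qed (intro vector_field_add Schouten_van_Kampen_field X X' Y)+
  moreover have "D X (Y + Y') = D X Y + D X Y'"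
    if X: "X \<in> vector_fields M" and Y: "Y \<in> vector_fields M" and Y': "Y' \<in> vector_fields M" for X Y Y'
    unfolding plus_fun_def[of Y] plus_fun_def[of "D X Y"]
  proof (rule vector_field_eqI)
    fix p assume p: "p \<in> points M"
    interpret A: almost_contact_B_space "tangent_space M p" n "\<phi> p" "\<xi> p" "\<eta> p" "g p"
      by (rule tangent_almost_contact_B_space[OF p])
    show "D X (\<lambda>p. Y p + Y' p) p = D X Y p + D X Y' p"
      using vector_field_add[OF Y Y'] X Y Y' p
      by (simp add: Schouten_van_Kampen_eq nabla_add \<xi>_field A.g_simps A.\<eta>_simps vector_field_tangent nabla_field
        algebra_simps)
  qed (intro vector_field_add Schouten_van_Kampen_field X Y Y')+
  moreover have "D (\<lambda>p. f p *\<^sub>R X p) Y = (\<lambda>p. f p *\<^sub>R D X Y p)"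
    if f: "f \<in> smooth_functions M" and X: "X \<in> vector_fields M" and Y: "Y \<in> vector_fields M" for f X Y
  proof (rule vector_field_eqI)
    fix p assume p: "p \<in> points M"
    interpret A: almost_contact_B_space "tangent_space M p" n "\<phi> p" "\<xi> p" "\<eta> p" "g p"
      by (rule tangent_almost_contact_B_space[OF p])
    show "D (\<lambda>p. f p *\<^sub>R X p) Y p = f p *\<^sub>R D X Y p"
      using vector_field_scale[OF f X] f X Y p
      by (simp add: Schouten_van_Kampen_eq nabla_scale_left \<xi>_field A.g_simps vector_field_tangent nabla_field
        algebra_simps)
  qed (intro vector_field_scale Schouten_van_Kampen_field f X Y)+
  moreover have "D X (\<lambda>p. f p *\<^sub>R Y p) = (\<lambda>p. X p f *\<^sub>R Y p + f p *\<^sub>R D X Y p)"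
    if f: "f \<in> smooth_functions M" and X: "X \<in> vector_fields M" and Y: "Y \<in> vector_fields M" for f X Y
  proof (rule vector_field_eqI)
    fix p assume p: "p \<in> points M"
    interpret A: almost_contact_B_space "tangent_space M p" n "\<phi> p" "\<xi> p" "\<eta> p" "g p"
      by (rule tangent_almost_contact_B_space[OF p])
    show "D X (\<lambda>p. f p *\<^sub>R Y p) p = X p f *\<^sub>R Y p + f p *\<^sub>R D X Y p"
      using vector_field_scale[OF f Y] f X Y p
      by (simp add: Schouten_van_Kampen_eq nabla_scale \<xi>_field A.g_simps A.\<eta>_simps vector_field_tangent nabla_field
        algebra_simps)
  qed (intro vector_field_add vector_field_scale vector_field_smooth[OF X f] Schouten_van_Kampen_field f X Y)+
  ultimately show ?thesis
    unfolding linear_connection_def using Schouten_van_Kampen_field by blast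
qed

context
  fixes p assumes p: "p \<in> points M"
begin

interpretation A: almost_contact_B_space "tangent_space M p" n "\<phi> p" "\<xi> p" "\<eta> p" "g p"
  by (rule tangent_almost_contact_B_space[OF p])

lemma Schouten_van_Kampen_\<xi>:
  assumes X: "X \<in> vector_fields M"
  shows "D X \<xi> p = 0"
  using X p by (simp add: Schouten_van_Kampen_eq \<xi>_field A.g_\<xi> A.\<eta>_\<xi> \<eta>_nabla_\<xi> tangent[OF p])

lemma Schouten_van_Kampen_\<eta>:
  assumes X: "X \<in> vector_fields M" and Y: "Y \<in> vector_fields M"
  shows "deriv_form D \<eta> X Y p = 0"
  using nabla_\<eta>[OF p X Y] X Y p
  by (simp add: deriv_form_def Schouten_van_Kampen_eq A.\<eta>_simps A.\<eta>_\<xi> \<eta>_nabla_\<xi> tangent[OF p])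

lemma Schouten_van_Kampen_metric:
  assumes X: "X \<in> vector_fields M" and Y: "Y \<in> vector_fields M" and Z: "Z \<in> vector_fields M"
  shows "deriv_metric D g X Y Z p = 0"
  using X Y Z p A.g_sym[of "\<xi> p" "Z p"] A.g_sym[of "Y p" "nabla X \<xi> p"]
  by (simp add: deriv_metric_def Schouten_van_Kampen_eq nabla_metric A.g_simps A.g_\<xi> tangent[OF p])

lemma Schouten_van_Kampen_\<phi>:
  assumes X: "X \<in> vector_fields M" and Y: "Y \<in> vector_fields M"
  shows "deriv_endo D \<phi> X Y p = deriv_endo nabla \<phi> X Y p
    + g p (nabla X \<xi> p) (\<phi> p (Y p)) *\<^sub>R \<xi> p + \<eta> p (Y p) *\<^sub>R \<phi> p (nabla X \<xi> p)"
  using X Y p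
  by (simp add: deriv_endo_def Schouten_van_Kampen_eq A.\<phi>_simps A.\<eta>_\<phi> A.\<phi>_\<xi> tangent[OF p])

text \<open>The heart of the matter: \<open>D\<phi>\<close> is the defect of \<open>F\<close> from being vertical, because
  \<open>F(x,y,\<xi>) = -g(\<nabla>\<^sub>x\<xi>, \<phi>y) = -g(\<phi>\<nabla>\<^sub>x\<xi>, y)\<close>.\<close>

lemma g_Schouten_van_Kampen_\<phi>:
  assumes X: "X \<in> vector_fields M" and Y: "Y \<in> vector_fields M" and Z: "Z \<in> vector_fields M"
  defines "F \<equiv> fundamental_tensor M \<phi> g nabla p"
  shows "g p (deriv_endo D \<phi> X Y p) (Z p) =
    F (X p) (Y p) (Z p) - (F (X p) (Y p) (\<xi> p) * \<eta> p (Z p) + F (X p) (Z p) (\<xi> p) * \<eta> p (Y p))"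
  unfolding F_def using X Y Z A.g_sym[of "\<xi> p" "Z p"] A.g_\<phi>_self_adjoint[of "nabla X \<xi> p" "Z p"]
  by (simp add: Schouten_van_Kampen_\<phi> fundamental_tensor_fields[OF p] fundamental_tensor_\<xi>[OF p]
    \<eta>_nabla_\<phi>[OF p] A.g_simps A.g_\<xi> tangent[OF p] deriv_endo_tangent[OF p])

lemma vertical_iff_Schouten_van_Kampen_\<phi>:
  "fundamental_tensor M \<phi> g nabla p \<in> vertical_F_space (tangent_space M p) (\<phi> p) (\<xi> p) (\<eta> p) \<longleftrightarrow>
    (\<forall>X\<in>vector_fields M. \<forall>Y\<in>vector_fields M. deriv_endo D \<phi> X Y p = 0)"
    (is "?F \<in> ?V \<longleftrightarrow> ?R")
proof
  assume F: "?F \<in> ?V"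
  show ?R
  proof (intro ballI)
    fix X Y assume XY: "X \<in> vector_fields M" "Y \<in> vector_fields M"
    show "deriv_endo D \<phi> X Y p = 0"
    proof (rule A.g_nondegenerate)
      show "deriv_endo D \<phi> X Y p \<in> tangent_space M p"
        unfolding deriv_endo_def
        by (intro A.V_closed vector_field_tangent[OF _ p] Schouten_van_Kampen_field \<phi>_field XY)
      fix z assume z: "z \<in> tangent_space M p"
      have "?F (X p) (Y p) z = ?F (X p) (Y p) (\<xi> p) * \<eta> p z + ?F (X p) z (\<xi> p) * \<eta> p (Y p)"
        using F z XY by (auto simp: vertical_F_space_def vector_field_tangent p)
      then show "g p (deriv_endo D \<phi> X Y p) z = 0"
        using g_Schouten_van_Kampen_\<phi>[OF XY extension_field(1)[OF p z]] extension_field(2)[OF p z] by simp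
    qed
  qed
next
  assume R: ?R
  have "?F x y z = ?F x y (\<xi> p) * \<eta> p z + ?F x z (\<xi> p) * \<eta> p y"
    if "x \<in> tangent_space M p" "y \<in> tangent_space M p" "z \<in> tangent_space M p" for x y z
  proof -
    note ext = extension_field[OF p that(1)] extension_field[OF p that(2)] extension_field[OF p that(3)]
    show ?thesis
      using g_Schouten_van_Kampen_\<phi>[OF ext(1,3,5)] R ext by (simp add: A.g_simps that)
  qed
  then show "?F \<in> ?V"
    using fundamental_tensor_F_space[OF p] unfolding vertical_F_space_def by blast
qed

text \<open>Evaluating \<open>D\<phi> = 0\<close> at \<open>\<phi>y\<close> gives \<open>(\<nabla>\<^sub>x\<phi>)\<phi>y = (\<nabla>\<^sub>x\<eta>)(y)\<xi>\<close>, so the two halves in the definition of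
  the \<open>\<phi>B\<close>-connection add up to the term \<open>(\<nabla>\<^sub>x\<eta>)(y)\<xi>\<close> of \<open>D\<close>.\<close>

lemma phiB_connection_eq:
  assumes X: "X \<in> vector_fields M" and Y: "Y \<in> vector_fields M"
    and D\<phi>: "deriv_endo D \<phi> X (\<lambda>q. \<phi> q (Y q)) p = 0"
  shows "D X Y p = phiB_connection \<phi> \<xi> \<eta> nabla X Y p"
proof -
  have "g p (nabla X \<xi> p) (\<phi> p (\<phi> p (Y p))) = - g p (nabla X \<xi> p) (Y p)"
    using X Y by (simp add: A.\<phi>_\<phi> A.g_simps A.g_\<xi> \<eta>_nabla_\<xi>[OF p] tangent[OF p])
  then have "deriv_endo nabla \<phi> X (\<lambda>q. \<phi> q (Y q)) p = g p (nabla X \<xi> p) (Y p) *\<^sub>R \<xi> p"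
    using D\<phi> Schouten_van_Kampen_\<phi>[OF X \<phi>_field[OF Y]] Y by (simp add: A.\<eta>_\<phi> tangent[OF p])
  then show ?thesis
    by (simp add: phiB_connection_def Schouten_van_Kampen_eq[OF X Y p] nabla_\<eta>[OF p X Y]
      scaleR_half_double algebra_simps flip: scaleR_left_distrib)
qed

end

lemma phiB_connection_outside:
  assumes "X \<in> vector_fields M" "Y \<in> vector_fields M" "p \<notin> points M"
  shows "phiB_connection \<phi> \<xi> \<eta> nabla X Y p = 0"
  using assms vector_field_outside[OF nabla_field] \<phi>_field \<xi>_field vector_field_outside[OF \<xi>_field]
  by (simp add: phiB_connection_def deriv_endo_def \<phi>_zero_outside)

text \<open>Whatever the class of the manifold, \<open>D\<close> preserves \<open>\<xi>\<close>, \<open>\<eta>\<close> and \<open>g\<close>: it is built from a metric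
  connection by projecting to two orthogonal distributions.  Naturality is therefore a condition on \<open>\<phi>\<close>.\<close>

lemma natural_connection_iff:
  "natural_connection M \<phi> \<xi> \<eta> g D \<longleftrightarrow>
    (\<forall>p\<in>points M. \<forall>X\<in>vector_fields M. \<forall>Y\<in>vector_fields M. deriv_endo D \<phi> X Y p = 0)"
  unfolding natural_connection_def
  using Schouten_van_Kampen_linear Schouten_van_Kampen_\<xi> Schouten_van_Kampen_\<eta> Schouten_van_Kampen_metric
  by blast

lemma belongs_to_U2_iff:
  "belongs_to_U2 M n \<phi> \<xi> \<eta> g nabla \<longleftrightarrow> natural_connection M \<phi> \<xi> \<eta> g D"
  unfolding belongs_to_U2_def natural_connection_iff
  using almost_contact_B_space.class_U2_eq[OF tangent_almost_contact_B_space]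
    vertical_iff_Schouten_van_Kampen_\<phi>
  by simp

end

theorem theorem3p3:
  fixes M :: "('a, 'e::euclidean_space) manifold" and n :: nat
    and \<phi> :: "'a \<Rightarrow> 'a tvector \<Rightarrow> 'a tvector" and \<xi> :: "'a vfield"
    and \<eta> :: "'a \<Rightarrow> 'a tvector \<Rightarrow> real" and g :: "'a \<Rightarrow> 'a tvector \<Rightarrow> 'a tvector \<Rightarrow> real"
    and nabla D :: "'a connection"
  assumes "almost_contact_B_metric_manifold M n \<phi> \<xi> \<eta> g"
    and "Levi_Civita_connection M g nabla"
    and "D = Schouten_van_Kampen \<xi> \<eta> nabla"
  shows "(natural_connection M \<phi> \<xi> \<eta> g D \<longleftrightarrow> belongs_to_U2 M n \<phi> \<xi> \<eta> g nabla) \<and>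
    (natural_connection M \<phi> \<xi> \<eta> g D \<longrightarrow>
      (\<forall>X\<in>vector_fields M. \<forall>Y\<in>vector_fields M. D X Y = phiB_connection \<phi> \<xi> \<eta> nabla X Y))"
proof -
  interpret almost_contact_B_manifold M n \<phi> \<xi> \<eta> g nabla
    by unfold_locales (fact assms)+
  have "D X Y = phiB_connection \<phi> \<xi> \<eta> nabla X Y"
    if "natural_connection M \<phi> \<xi> \<eta> g D" and X: "X \<in> vector_fields M" and Y: "Y \<in> vector_fields M" for X Y
  proof
    fix p
    show "D X Y p = phiB_connection \<phi> \<xi> \<eta> nabla X Y p"
    proof (cases "p \<in> points M")
      case True
      then show ?thesis
        using that \<phi>_field[OF Y] phiB_connection_eq[OF True X Y] unfolding assms(3) natural_connection_iff by blast
    next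
      case False
      then show ?thesis
        using vector_field_outside[OF Schouten_van_Kampen_field[OF X Y]] phiB_connection_outside[OF X Y]
        by (simp add: assms(3))
    qed
  qed
  then show ?thesis
    using belongs_to_U2_iff assms(3) by blast
qed

end
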